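(* Let $n\ge 3$. As automorphisms of $\mathfrak{aw}(n)$, the maps $r_0,r_1,\dots,r_{n-1}$ satisfy $$(\Delta_{0,\dots,n-1})^2=(\Delta_{0,\dots,n-2})^2=(\Delta_{1,\dots,n-1})^2=\mathrm{Id}.$$ These relations are equivalent (given the braid relations satisfied by the $r_a$) to $$(\Delta_{1,\dots,n-1})^2=\mathrm{Id},\qquad r_{n-1}\cdots r_1r_0^2r_1\cdots r_{n-1}=\mathrm{Id}.$$ In particular $$r_0^2=\bar r_1\cdots\bar r_{n-2}\,\bar r_{n-1}^{\,2}\,\bar r_{n-2}\cdots\bar r_1=(\Delta_{2,\dots,n-1})^2 .$$
   Context: Base field $\mathbb{C}(q)$, $q$ an indeterminate. $[A,B]=AB-BA$, $[A,B]_q=\frac{1}{q-q^{-1}}(qAB-q^{-1}BA)$. For $I,J\subseteq\{1,\dots,n\}$, $I<J$ means every element of $I$ is strictly smaller than every element of $J$. A connected subset is a non-empty set of consecutive integers. Two disjoint connected subsets are adjacent if their union is connected. A sequence $(I_1,\dots,I_k)$ of connected subsets is monotonic if $I_1<\dots<I_k$ or $I_1>\dots>I_k$; it is a monotonic sequence of adjacent subsets if moreover $I_j,I_{j+1}$ are adjacent for all $j$. Elements: $C_I$ for $I\subseteq\{1,\dots,n\}$ connected; $C_\varnothing:=1$; $C_{j\dots k}:=C_{\{j,j+1,\dots,k\}}$. Adjacent sets in an index are merged: if $I_1,I_2$ are disjoint, connected and adjacent then $C_{I_1I_2}=C_{I_2I_1}:=C_{I_1\cup I_2}$ (similarly for more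 sets; e.g. $C_{I_1I_3I_4}$ with $I_3,I_4$ adjacent means $C_{I_1(I_3\cup I_4)}$); empty sets in an index are dropped. If $I_1,I_2$ are disjoint connected subsets and the hole $H$ between them (the set of integers strictly between $I_1$ and $I_2$) is non-empty, then $$C_{I_1I_2}:=-[C_{I_1H},C_{HI_2}]_q+C_{I_1}C_{I_2}+C_HC_{I_1HI_2}$$ (the order of the pair $(I_1,I_2)$ matters: in general $C_{I_1I_2}\ne C_{I_2I_1}$). The algebra $\mathfrak{aw}(n)$ is the unital associative algebra generated by the $C_I$, $I$ a connected subset of $\{1,\dots,n\}$, with relations: (i) $[C_I,C_J]=0$ for connected $I,J$ with $I\cap J=\varnothing$ or $I\subset J$; (ii) $C_{I_1I_2}=-[C_{I_2I_3},C_{I_1I_3}]_q+C_{I_1}C_{I_2}+C_{I_3}C_{I_1I_2I_3}$ for every monotonic sequence $(I_1,I_2,I_3)$ of adjacent connected subsets; (iii) $C_{I_1I_4}=-[C_{I_1I_3},C_{I_3I_4}]_q+C_{I_1}C_{I_4}+C_{I_3}C_{I_1I_3I_4}$ for every monotonic sequence $(I_1,I_2,I_3,I_4)$ of adjacent connected subsets. The maps $r_a$ ($0\le a\le n-1$) are the algebra automorphisms of $\mathfrak{aw}(n)$ (they are known to be well defined and to satisfy the braid relations $r_ar_{a+1}r_a=r_{a+1}r_ar_{a+1}$, $r_ar_b=r_br_a$ for $|a-b|>1$) given on generators as follows. For $1\le i\le n-1$: $r_i(C_{i+1\dots k})=C_{\{i\}\{i+2,\dots,k\}}$ for $k\ge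 i+1$; $r_i(C_{j\dots i})=C_{\{i+1\}\{j,\dots,i-1\}}$ for $j\le i$; $r_i(C_{j\dots k})=C_{j\dots k}$ if $\{i,i+1\}\subset\{j,\dots,k\}$ or $\{i,i+1\}\cap\{j,\dots,k\}=\varnothing$. And $r_0(C_{j\dots k})=C_{j\dots k}$ for $2\le j\le k\le n$, $r_0(C_{1\dots k})=C_{\{k+1,\dots,n\}\{1\}}$ for $1\le k\le n$. $\bar r_a$ denotes the inverse automorphism of $r_a$. Products of maps denote composition. For $a\le b$ put $$\Delta_{a,\dots,b}=r_a\cdot (r_{a+1}r_a)\cdots (r_b\cdots r_{a+1}r_a)=(r_ar_{a+1}\cdots r_b)\cdots(r_ar_{a+1})\cdot r_a$$ (the two expressions coincide by the braid relations). *)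

theory Defs
  imports
    "HOL-Algebra.QuotRing"
    "HOL-Algebra.Module"
    "HOL-Algebra.Bij"
    "HOL-Computational_Algebra.Polynomial"
    "HOL-Computational_Algebra.Fraction_Field"
    "HOL-Library.Poly_Mapping"
begin

type_synonym Cq = "complex poly fract"

definition qq :: Cq where
  "qq = Fract [:0, 1:] 1"

section \<open>Free algebras\<close>

text \<open>
  Words form an additive monoid under concatenation, so that the convolution product of
  finitely supported functions on words is the product of the free algebra over the field.
\<close>

datatype 'a fword = FWord (letters: "'a list")

instantiation fword :: (type) monoid_add
begin

definition zero_fword :: "'a fword" where
  "zero_fword = FWord []"

definition plus_fword :: "'a fword \<Rightarrow> 'a fword \<Rightarrow> 'a fword" where
  "plus_fword u v = FWord (letters u @ letters v)"

instance
  by standard (simp_all add: zero_fword_def plus_fword_def)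

end

type_synonym 'a free = "'a fword \<Rightarrow>\<^sub>0 Cq"

definition const :: "Cq \<Rightarrow> 'a free" where
  "const c = Poly_Mapping.single 0 c"

definition letter :: "'a \<Rightarrow> 'a free" where
  "letter x = Poly_Mapping.single (FWord [x]) 1"

definition free_alg :: "'a set \<Rightarrow> 'a free ring" where
  "free_alg X =
     \<lparr>carrier = {p. \<forall>w \<in> Poly_Mapping.keys p. set (letters w) \<subseteq> X},
      monoid.mult = (*), one = 1, zero = 0, add = (+)\<rparr>"

text \<open>The algebra presented by generators \<open>X\<close> and relators \<open>S\<close>.\<close>

definition presented_alg :: "'a set \<Rightarrow> 'a free set \<Rightarrow> (Cq, 'a free set) module" where
  "presented_alg X S =
     (let F = free_alg X; I = genideal F S; Q = F Quot I in
      \<lparr>carrier = carrier Q, monoid.mult = monoid.mult Q, one = one Q, zero = zero Q, add = add Q,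
       module.smult = (\<lambda>c x. monoid.mult Q (I +>\<^bsub>F\<^esub> const c) x)\<rparr>)"

section \<open>The generators and the elements with two-component index\<close>

definition qcomm :: "'a free \<Rightarrow> 'a free \<Rightarrow> 'a free" where
  "qcomm A B = const (1 / (qq - 1 / qq)) * (const qq * A * B - const (1 / qq) * B * A)"

definition connected_set :: "nat set \<Rightarrow> bool" where
  "connected_set I \<longleftrightarrow> (\<exists>j k. j \<le> k \<and> I = {j..k})"

definition conn :: "nat \<Rightarrow> nat set set" where
  "conn n = {I. connected_set I \<and> I \<subseteq> {1..n}}"

definition set_less :: "nat set \<Rightarrow> nat set \<Rightarrow> bool" where
  "set_less I J \<longleftrightarrow> (\<forall>i\<in>I. \<forall>j\<in>J. i < j)"

definition adjacent :: "nat set \<Rightarrow> nat set \<Rightarrow> bool" where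
  "adjacent I J \<longleftrightarrow> I \<inter> J = {} \<and> connected_set (I \<union> J)"

text \<open>Monotonic sequences of adjacent connected subsets of \<open>{1..n}\<close>.\<close>

definition mono_adj :: "nat \<Rightarrow> nat set list \<Rightarrow> bool" where
  "mono_adj n Is \<longleftrightarrow> set Is \<subseteq> conn n \<and>
     ((\<forall>i. Suc i < length Is \<longrightarrow> set_less (Is ! i) (Is ! Suc i)) \<or>
      (\<forall>i. Suc i < length Is \<longrightarrow> set_less (Is ! Suc i) (Is ! i))) \<and>
     (\<forall>i. Suc i < length Is \<longrightarrow> adjacent (Is ! i) (Is ! Suc i))"

definition hole :: "nat set \<Rightarrow> nat set \<Rightarrow> nat set" where
  "hole I J = {x. (\<forall>i\<in>I. \<forall>j\<in>J. i < x \<and> x < j) \<or> (\<forall>i\<in>I. \<forall>j\<in>J. j < x \<and> x < i)}"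

definition gen :: "nat set \<Rightarrow> nat set free" where
  "gen I = (if I = {} then 1 else letter I)"

text \<open>
  \<open>gen2 I J\<close> lifts \<open>C\<^bsub>IJ\<^esub>\<close> to the free algebra, for disjoint \<open>I\<close>, \<open>J\<close> that are connected
  or empty.  Empty sets in the index are dropped and adjacent sets are merged.
\<close>

definition gen2 :: "nat set \<Rightarrow> nat set \<Rightarrow> nat set free" where
  "gen2 I J =
     (if I = {} \<or> J = {} \<or> hole I J = {} then gen (I \<union> J)
      else let H = hole I J in
        - qcomm (gen (I \<union> H)) (gen (H \<union> J)) + gen I * gen J + gen H * gen (I \<union> H \<union> J))"

section \<open>The algebra \<open>aw(n)\<close>\<close>

text \<open>Each relation \<open>A = B\<close> is represented by the relator \<open>A - B\<close>.\<close>

definition rel_i :: "nat \<Rightarrow> nat set free set" where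
  "rel_i n = {gen I * gen J - gen J * gen I | I J.
     I \<in> conn n \<and> J \<in> conn n \<and> (I \<inter> J = {} \<or> I \<subseteq> J)}"

definition rel_ii :: "nat \<Rightarrow> nat set free set" where
  "rel_ii n =
     {gen (I1 \<union> I2) -
        (- qcomm (gen (I2 \<union> I3)) (gen2 I1 I3) + gen I1 * gen I2 + gen I3 * gen (I1 \<union> I2 \<union> I3))
      | I1 I2 I3. mono_adj n [I1, I2, I3]}"

definition rel_iii :: "nat \<Rightarrow> nat set free set" where
  "rel_iii n =
     {gen2 I1 I4 -
        (- qcomm (gen2 I1 I3) (gen (I3 \<union> I4)) + gen I1 * gen I4 + gen I3 * gen2 I1 (I3 \<union> I4))
      | I1 I2 I3 I4. mono_adj n [I1, I2, I3, I4]}"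

abbreviation rels :: "nat \<Rightarrow> nat set free set" where
  "rels n \<equiv> rel_i n \<union> rel_ii n \<union> rel_iii n"

definition aw :: "nat \<Rightarrow> (Cq, nat set free set) module" where
  "aw n = presented_alg (conn n) (rels n)"

definition aw_class :: "nat \<Rightarrow> nat set free \<Rightarrow> nat set free set" where
  "aw_class n p = genideal (free_alg (conn n)) (rels n) +>\<^bsub>free_alg (conn n)\<^esub> p"

definition C :: "nat \<Rightarrow> nat set \<Rightarrow> nat set free set" where
  "C n I = aw_class n (gen I)"

definition C2 :: "nat \<Rightarrow> nat set \<Rightarrow> nat set \<Rightarrow> nat set free set" where
  "C2 n I J = aw_class n (gen2 I J)"

section \<open>Automorphisms and the maps \<open>r\<^sub>a\<close>\<close>

definition alg_auto :: "(Cq, 'b) module \<Rightarrow> ('b \<Rightarrow> 'b) set" where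
  "alg_auto A = {f \<in> ring_hom A A \<inter> Bij (carrier A).
     \<forall>c. \<forall>x \<in> carrier A. f (c \<odot>\<^bsub>A\<^esub> x) = c \<odot>\<^bsub>A\<^esub> f x}"

text \<open>The product of \<open>BijGroup\<close> is composition, the right factor being applied first.\<close>

definition AlgAut :: "(Cq, 'b) module \<Rightarrow> ('b \<Rightarrow> 'b) monoid" where
  "AlgAut A = BijGroup (carrier A) \<lparr>carrier := alg_auto A\<rparr>"

text \<open>
  An automorphism is determined by its values on the generators, so \<open>is_r n a\<close> holds of
  at most one \<open>f\<close>.
\<close>

definition is_r :: "nat \<Rightarrow> nat \<Rightarrow> (nat set free set \<Rightarrow> nat set free set) \<Rightarrow> bool" where
  "is_r n a f \<longleftrightarrow> f \<in> carrier (AlgAut (aw n)) \<and>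
     (if a = 0 then
        (\<forall>j k. 2 \<le> j \<and> j \<le> k \<and> k \<le> n \<longrightarrow> f (C n {j..k}) = C n {j..k}) \<and>
        (\<forall>k. 1 \<le> k \<and> k \<le> n \<longrightarrow> f (C n {1..k}) = C2 n {k+1..n} {1})
      else
        (\<forall>k. a + 1 \<le> k \<and> k \<le> n \<longrightarrow> f (C n {a+1..k}) = C2 n {a} {a+2..k}) \<and>
        (\<forall>j. 1 \<le> j \<and> j \<le> a \<longrightarrow> f (C n {j..a}) = C2 n {a+1} {j..a-1}) \<and>
        (\<forall>j k. 1 \<le> j \<and> j \<le> k \<and> k \<le> n \<and>
           ({a, a+1} \<subseteq> {j..k} \<or> {a, a+1} \<inter> {j..k} = {}) \<longrightarrow>
           f (C n {j..k}) = C n {j..k}))"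

section \<open>Half twists in a group\<close>

definition mprod :: "('g, 'm) monoid_scheme \<Rightarrow> 'g list \<Rightarrow> 'g" where
  "mprod G xs = foldr (monoid.mult G) xs (one G)"

text \<open>\<open>\<Delta> G \<rho> a b = \<rho>\<^sub>a (\<rho>\<^bsub>a+1\<^esub> \<rho>\<^sub>a) \<dots> (\<rho>\<^sub>b \<dots> \<rho>\<^bsub>a+1\<^esub> \<rho>\<^sub>a)\<close>\<close>

definition \<Delta> :: "('g, 'm) monoid_scheme \<Rightarrow> (nat \<Rightarrow> 'g) \<Rightarrow> nat \<Rightarrow> nat \<Rightarrow> 'g" where
  "\<Delta> G \<rho> a b = mprod G (map (\<lambda>k. mprod G (map \<rho> (rev [a..<Suc k]))) [a..<Suc b])"

definition braid_relations :: "('g, 'm) monoid_scheme \<Rightarrow> (nat \<Rightarrow> 'g) \<Rightarrow> nat \<Rightarrow> bool" where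
  "braid_relations G \<rho> n \<longleftrightarrow>
     (\<forall>a. a + 1 < n \<longrightarrow> \<rho> a \<otimes>\<^bsub>G\<^esub> \<rho> (a+1) \<otimes>\<^bsub>G\<^esub> \<rho> a = \<rho> (a+1) \<otimes>\<^bsub>G\<^esub> \<rho> a \<otimes>\<^bsub>G\<^esub> \<rho> (a+1)) \<and>
     (\<forall>a b. a + 1 < b \<and> b < n \<longrightarrow> \<rho> a \<otimes>\<^bsub>G\<^esub> \<rho> b = \<rho> b \<otimes>\<^bsub>G\<^esub> \<rho> a)"

definition half_twist_relations :: "('g, 'm) monoid_scheme \<Rightarrow> (nat \<Rightarrow> 'g) \<Rightarrow> nat \<Rightarrow> bool" where
  "half_twist_relations G \<rho> n \<longleftrightarrow>
     \<Delta> G \<rho> 0 (n-1) [^]\<^bsub>G\<^esub> (2::nat) = \<one>\<^bsub>G\<^esub> \<and>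
     \<Delta> G \<rho> 0 (n-2) [^]\<^bsub>G\<^esub> (2::nat) = \<one>\<^bsub>G\<^esub> \<and>
     \<Delta> G \<rho> 1 (n-1) [^]\<^bsub>G\<^esub> (2::nat) = \<one>\<^bsub>G\<^esub>"

definition sphere_relations :: "('g, 'm) monoid_scheme \<Rightarrow> (nat \<Rightarrow> 'g) \<Rightarrow> nat \<Rightarrow> bool" where
  "sphere_relations G \<rho> n \<longleftrightarrow>
     \<Delta> G \<rho> 1 (n-1) [^]\<^bsub>G\<^esub> (2::nat) = \<one>\<^bsub>G\<^esub> \<and>
     mprod G (map \<rho> (rev [1..<n])) \<otimes>\<^bsub>G\<^esub> \<rho> 0 [^]\<^bsub>G\<^esub> (2::nat) \<otimes>\<^bsub>G\<^esub> mprod G (map \<rho> [1..<n])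
       = \<one>\<^bsub>G\<^esub>"

end

theory Submission
  imports Defs
begin

text \<open>
  Write \<open>E(j - 1, k)\<close> for \<open>C\<close> with index \<open>{j..k}\<close> and think of it as a chord of a polygon with vertex set
  \<open>\<int> / (n + 1)\<close>, setting \<open>E(a, b) = E(b, a)\<close> and \<open>E(a, a) = 1\<close>.  Then the defining relations become
  relations for the chords of quadrilaterals and pentagons, and \<open>r\<^sub>a\<close> moves only the chords ending at the
  vertex \<open>a\<close>, all \<open>r\<^sub>a\<close> (including \<open>r\<^sub>0\<close>) being given by the same formula.  The pentagon relations are
  stated in a way that is not invariant under rotation of the polygon, but they imply their rotated
  versions.  Hence \<open>r\<^sub>n\<^sub>-\<^sub>1 \<cdots> r\<^sub>1 r\<^sub>0\<close> rotates the polygon by one step and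
  \<open>r\<^sub>0 r\<^sub>1 \<cdots> r\<^sub>n\<^sub>-\<^sub>1\<close> rotates it back, which gives the sphere relation and shows that the
  Coxeter element has order dividing \<open>n + 1\<close>.  The rotation also conjugates \<open>r\<^sub>a\<^sub>+\<^sub>1\<close> to \<open>r\<^sub>a\<close>; together with
  the commutation of distant twists this yields the braid relations.  What remains is a computation
  in the braid group: the square of the half twist is the \<open>(n + 1)\<close>-st power of the Coxeter element.
\<close>

section \<open>The q-bracket\<close>

text \<open>An interval is recorded by the two gaps that bound it. The chord from n to 0 is the full
  interval {1..n}; with it as closing side, vertex 0 looks like any other vertex and
  \<open>r 0\<close> like any other twist. The obstacle is that relation (iii) is given only for
  sequences that do not pass vertex 0, whereas a sweep around the polygon needs the pentagon in
  every position. The rotated pentagon can be recovered because the quadrilateral relations collapse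
  a double bracket with one diagonal: the bracket of ac with [bd, ac]_q is bd up to products of
  commuting chords. Why a product of twists rotates: the twist at j turns the chord (j, k) into a
  crossing, each further twist slides this crossing by one vertex, and on reaching k it degenerates
  to (j - 1, k - 1). The opposite rotation is the same statement for the mirrored polygon, which is
  where the reversed pentagon relations enter. In the group, the square of
  \<open>half_twist 0 n\<close> encloses the square of either shorter half twist between the Coxeter
  element and its reverse; once these two are mutually inverse, triviality passes from one square to
  the others.\<close>

locale qbracket =
  fixes \<alpha> :: "'a :: {ring, monoid_mult}"
  assumes central: "x * \<alpha> = \<alpha> * x"
begin

text \<open>This is \<open>[x, y]\<^sub>q\<close> for \<open>\<alpha> = q / (q - q\<^sup>-\<^sup>1)\<close>.\<close>

definition qbr :: "'a \<Rightarrow> 'a \<Rightarrow> 'a" where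
  "qbr x y = \<alpha> * (x * y - y * x) + y * x"

definition skein :: "'a \<Rightarrow> 'a \<Rightarrow> 'a \<Rightarrow> 'a \<Rightarrow> 'a \<Rightarrow> 'a \<Rightarrow> 'a" where
  "skein x y s t u v = - qbr x y + s * t + u * v"

lemma scalar_simps:
  "NO_MATCH \<alpha> x \<Longrightarrow> x * \<alpha> = \<alpha> * x" "NO_MATCH \<alpha> x \<Longrightarrow> x * (\<alpha> * y) = \<alpha> * (x * y)"
  by (rule central) (metis central mult.assoc)

lemma qbr_add [simp]: "qbr (x + y) z = qbr x z + qbr y z" "qbr z (x + y) = qbr z x + qbr z y"
  by (simp_all add: qbr_def algebra_simps)

lemma qbr_minus [simp]: "qbr (- x) z = - qbr x z" "qbr z (- x) = - qbr z x"
  by (simp_all add: qbr_def algebra_simps)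

lemma qbr_diff [simp]: "qbr (x - y) z = qbr x z - qbr y z" "qbr z (x - y) = qbr z x - qbr z y"
  by (simp_all add: qbr_def algebra_simps)

lemma qbr_commuting: "x * y = y * x \<Longrightarrow> qbr x y = x * y"
  by (simp add: qbr_def)

lemma qbr_scale_left:
  assumes "s * y = y * s"
  shows "qbr (s * x) y = s * qbr x y"
proof -
  have "y * (s * x) = s * (y * x)" by (metis assms mult.assoc)
  then show ?thesis by (simp add: qbr_def algebra_simps scalar_simps)
qed

lemma qbr_scale_right:
  assumes "s * x = x * s"
  shows "qbr x (s * y) = s * qbr x y"
proof -
  have "x * (s * y) = s * (x * y)" by (metis assms mult.assoc)
  then show ?thesis by (simp add: qbr_def algebra_simps scalar_simps)
qed

text \<open>Bracketing with x from the left combines left and right multiplication by x, and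
  bracketing with z from the right those by z. All these operators commute as soon as x and z do.
  The same reason gives \<open>qbr_left_commute\<close> and, for z = x,
  \<open>qbr_flip\<close>.\<close>

lemma qbr_assoc:
  assumes "x * z = z * x"
  shows "qbr (qbr x y) z = qbr x (qbr y z)"
proof -
  have "z * (x * y) = x * (z * y)" by (metis assms mult.assoc)
  then show ?thesis
    by (simp add: qbr_def algebra_simps scalar_simps assms)
qed

lemma qbr_left_commute:
  assumes "x * y = y * x"
  shows "qbr x (qbr y z) = qbr y (qbr x z)"
proof -
  have "y * (x * z) = x * (y * z)" by (metis assms mult.assoc)
  then show ?thesis
    by (simp add: qbr_def algebra_simps scalar_simps assms)
qed

lemma qbr_flip: "qbr x (qbr y x) = qbr (qbr x y) x"
  by (simp add: qbr_def algebra_simps scalar_simps)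

lemma qbr_br_commuting:
  assumes "x * y = y * x" "x * z = z * x"
  shows "qbr x (qbr y z) = x * qbr y z"
proof -
  have "x * (y * z) = y * z * x" "x * (z * y) = z * y * x"
    by (metis assms mult.assoc)+
  then have "x * qbr y z = qbr y z * x"
    by (simp add: qbr_def algebra_simps scalar_simps)
  then show ?thesis by (rule qbr_commuting)
qed

text \<open>The hypothesis is a quadrilateral relation with its crossing written out. Solved for the
  double bracket, it says that bracketing with y on both sides returns x up to products.\<close>

lemma skein_flip:
  assumes "x = skein y (skein x y s t u v) s u t v"
    and "y * s = s * y" "y * t = t * y" "y * u = u * y" "y * v = v * y"
  shows "qbr y (qbr x y) = x + y * s * t + y * u * v - s * u - t * v"
proof -
  have "y * (s * t) = s * t * y" "y * (u * v) = u * v * y"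
    by (metis assms(2-5) mult.assoc)+
  then have *: "qbr y (s * t) = y * (s * t)" "qbr y (u * v) = y * (u * v)"
    by (simp_all add: qbr_commuting)
  from assms(1) have "x = qbr y (qbr x y) - y * (s * t) - y * (u * v) + s * u + t * v"
    by (simp add: skein_def *)
  then show ?thesis by (simp add: algebra_simps)
qed

text \<open>The variable xy stands for the chord from x to y in a pentagon with vertices a, b, c, d,
  e. Sides commute with everything, diagonals with those sharing a vertex. The conclusion is
  \<open>pent\<close> with every vertex advanced by one.\<close>

lemma pentagon_rotate:
  assumes commute:
      "bc * ab = ab * bc" "cd * ab = ab * cd" "de * ab = ab * de" "ae * ab = ab * ae"
      "ac * ab = ab * ac" "bd * ab = ab * bd" "ce * ab = ab * ce" "ad * ab = ab * ad"
      "be * ab = ab * be" "cd * bc = bc * cd" "de * bc = bc * de" "ae * bc = bc * ae"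
      "ac * bc = bc * ac" "bd * bc = bc * bd" "ce * bc = bc * ce" "ad * bc = bc * ad"
      "be * bc = bc * be" "de * cd = cd * de" "ae * cd = cd * ae" "ac * cd = cd * ac"
      "bd * cd = cd * bd" "ce * cd = cd * ce" "ad * cd = cd * ad" "be * cd = cd * be"
      "ae * de = de * ae" "ac * de = de * ac" "bd * de = de * bd" "ce * de = de * ce"
      "ad * de = de * ad" "be * de = de * be" "ac * ae = ae * ac" "bd * ae = ae * bd"
      "ce * ae = ae * ce" "ad * ae = ae * ad" "be * ae = ae * be" "ce * ac = ac * ce"
      "be * ce = ce * be" "be * bd = bd * be" "bd * ad = ad * bd" "ad * ac = ac * ad"
    and quads:
      "qbr ac (qbr bd ac) = bd + ac * ab * cd + ac * bc * ad - ab * ad - bc * cd"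
      "qbr ac (qbr be ac) = be + ac * ab * ce + ac * bc * ae - ab * ae - bc * ce"
      "qbr ad (qbr be ad) = be + ad * ab * de + ad * bd * ae - ab * ae - bd * de"
      "qbr ad (qbr ce ad) = ce + ad * ac * de + ad * cd * ae - ac * ae - cd * de"
    and pent: "qbr (qbr ce bd) ac =
      - qbr be ad + bd * ae + bc * qbr ce ad + cd * qbr be ac - bc * cd * ae"
  shows "qbr (qbr ad ce) bd =
      - qbr ac be + ce * ab + cd * qbr ad be + de * qbr ac bd - cd * de * ab"
proof -
  have lcomm: "\<And>x. b * (a * x) = a * (b * x)" if "b * a = a * b" for a b :: 'a
    by (metis that mult.assoc)
  note C = commute commute[THEN lcomm]
  \<comment> \<open>The claim results from \<open>pent\<close> by applying first \<open>qbr ac\<close> and then \<open>qbr ad\<close>.\<close>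
  note S = qbr_scale_left qbr_scale_right qbr_commuting qbr_br_commuting C
  \<comment> \<open>Since ce commutes with ac it can be pulled out, leaving a double bracket of bd
    with ac that \<open>quads\<close> evaluates. On the other side of \<open>pent\<close> the same
    happens to be.\<close>
  have "qbr ac (qbr (qbr ce bd) ac) = qbr ce (qbr ac (qbr bd ac))"
    by (simp only: qbr_assoc[of ce ac bd] qbr_flip[of ac bd] qbr_left_commute[of ac ce] C)
  then have "qbr ce bd - ab * qbr ce ad = - qbr ac (qbr be ad) + ae * qbr ac bd + cd * be - cd * ab * ae"
    unfolding pent quads by (simp add: S quads algebra_simps)
  \<comment> \<open>The second bracket removes ad from the remaining brackets of ce and be with ad;
    on the right it first passes ac, with which ad commutes.\<close>
  then have "qbr ad (qbr ce bd - ab * qbr ce ad) =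
      qbr ad (- qbr ac (qbr be ad) + ae * qbr ac bd + cd * be - cd * ab * ae)"
    by simp
  then have "qbr ad (qbr ce bd) = - qbr ac be + ce * ab + cd * qbr ad be + de * qbr ac bd - cd * de * ab"
    by (simp add: S quads qbr_left_commute[of ad ac] algebra_simps)
  then show ?thesis by (simp add: qbr_assoc C)
qed

end

section \<open>Chords of a polygon\<close>

text \<open>Vertices are naturals read modulo N, so a cyclic order can be written as an increasing
  list from a to at most a + N. The weak inequalities include chords with a common vertex and
  trivial chords.\<close>

locale chords = qbracket \<alpha> for \<alpha> :: "'a :: {ring, monoid_mult}" +
  fixes N :: nat and E :: "nat \<Rightarrow> nat \<Rightarrow> 'a"
  assumes N_pos: "N > 0"
    and E_sym: "E a b = E b a"
    and E_refl [simp]: "E a a = 1"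
    and E_mod: "E (a mod N) b = E a b"
    and E_commute_linear: "\<lbrakk>a \<le> b; b \<le> c; c \<le> d; d < N\<rbrakk> \<Longrightarrow>
      E a b * E c d = E c d * E a b \<and> E b c * E a d = E a d * E b c"
begin

text \<open>For a < b < c < d < N this is C_{IJ} with I = {a+1..b} and J = {c+1..d}; the cyclic list
  b, c, d, a gives C_{JI}.\<close>

definition skein_chord :: "nat \<Rightarrow> nat \<Rightarrow> nat \<Rightarrow> nat \<Rightarrow> 'a" where
  "skein_chord a b c d = skein (E a c) (E b d) (E a b) (E c d) (E b c) (E a d)"

text \<open>Relation (iii) for the sides of a pentagon in descending order, with all \<open>C\<^bsub>IJ\<^esub>\<close> written out.\<close>

definition pent :: "nat \<Rightarrow> nat \<Rightarrow> nat \<Rightarrow> nat \<Rightarrow> nat \<Rightarrow> bool" where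
  "pent a b c d e \<longleftrightarrow> qbr (qbr (E c e) (E b d)) (E a c) =
     - qbr (E b e) (E a d) + E b d * E a e + E b c * qbr (E c e) (E a d)
     + E c d * qbr (E b e) (E a c) - E b c * E c d * E a e"

lemma E_cong: "a mod N = a' mod N \<Longrightarrow> b mod N = b' mod N \<Longrightarrow> E a b = E a' b'"
  by (metis E_mod E_sym)

lemma E_shift [simp]: "E (a + N) b = E a b" "E b (a + N) = E b a"
  by (auto intro: E_cong)

lemma E_sub: "N \<le> a \<Longrightarrow> E (a - N) b = E a b" "N \<le> a \<Longrightarrow> E b (a - N) = E b a"
  using E_shift(1)[of "a - N" b] E_shift(2)[of b "a - N"] by simp_all

lemma E_commute:
  "\<lbrakk>a \<le> b; b \<le> c; c \<le> d; d \<le> a + N\<rbrakk> \<Longrightarrow>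
    E a b * E c d = E c d * E a b \<and> E b c * E a d = E a d * E b c"
proof (induction "a + b + c + d" arbitrary: a b c d rule: less_induct)
  case less
  show ?case
  proof (cases "d < N")
    case True
    then show ?thesis using less.prems E_commute_linear by blast
  next
    case False
    \<comment> \<open>The last vertex moves to the front as d - N, which exchanges the two
      commutation statements. The inductions for \<open>quad\<close> and \<open>pent\<close> follow
      the same pattern.\<close>
    then have "E (d - N) a * E b c = E b c * E (d - N) a \<and> E a b * E (d - N) c = E (d - N) c * E a b"
      using less.prems N_pos by (intro less.hyps) auto
    then show ?thesis using False by (simp add: E_sub E_sym)
  qed
qed

lemma skein_chord_cong:
  "\<lbrakk>a mod N = a' mod N; b mod N = b' mod N; c mod N = c' mod N; d mod N = d' mod N\<rbrakk> \<Longrightarrow>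
    skein_chord a b c d = skein_chord a' b' c' d'"
  unfolding skein_chord_def by (metis E_cong)

text \<open>When the crossings are expanded, all terms containing the side \<open>E d e\<close>
  cancel. In the reversed version \<open>pent_revI\<close> those containing \<open>E a b\<close>
  do.\<close>

lemma pentI:
  assumes ord: "a \<le> b" "b \<le> c" "c \<le> d" "d \<le> e" "e \<le> a + N"
    and eq: "skein (E b e) (E a d) (E d e) (E a b) (E b d) (E a e) =
      skein (skein (E c e) (E b d) (E d e) (E b c) (E c d) (E b e)) (E a c) (E d e) (E a b)
        (E b c) (skein (E c e) (E a d) (E d e) (E a c) (E c d) (E a e))"
  shows "pent a b c d e"
proof -
  have comm: "E b c * E d e = E d e * E b c" "E a c * E b c = E b c * E a c"
    "E a c * E d e = E d e * E a c" "E c d * E a c = E a c * E c d"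
    using E_commute[of b c d e] E_commute[of a b c c] E_commute[of a c d e] E_commute[of a c c d] ord
    by simp_all
  have "E b c * (E d e * x) = E d e * (E b c * x)" for x
    by (metis comm(1) mult.assoc)
  then show ?thesis
    using eq by (simp add: pent_def skein_def qbr_scale_left qbr_commuting comm(2-4) algebra_simps)
qed

lemma pent_revI:
  assumes ord: "a \<le> b" "b \<le> c" "c \<le> d" "d \<le> e" "e \<le> a + N"
    and eq: "skein (E a d) (E b e) (E a b) (E d e) (E b d) (E a e) =
      skein (skein (E a c) (E b d) (E a b) (E c d) (E b c) (E a d)) (E c e) (E a b) (E d e)
        (E c d) (skein (E a c) (E b e) (E a b) (E c e) (E b c) (E a e))"
  shows "pent e d c b a"
proof -
  have comm: "E c d * E a b = E a b * E c d" "E c e * E c d = E c d * E c e"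
    "E c e * E a b = E a b * E c e" "E b c * E c e = E c e * E b c"
    using E_commute[of a b c d] E_commute[of c c d e] E_commute[of a b c e] E_commute[of b c c e] ord
    by simp_all
  have "E c d * (E a b * x) = E a b * (E c d * x)" for x
    by (metis comm(1) mult.assoc)
  moreover have "E e c = E c e" "E d b = E b d" "E c a = E a c" "E d a = E a d" "E e b = E b e"
    "E e a = E a e" "E d c = E c d" "E c b = E b c"
    by (simp_all add: E_sym)
  ultimately show ?thesis
    using eq by (simp add: pent_def skein_def qbr_scale_left qbr_commuting comm(2-4) algebra_simps)
qed

text \<open>The conventions for indices in cyclic form: two cyclically adjacent pieces merge, and an
  empty piece drops out. They allow one formula for the twists without case distinctions.\<close>

lemma skein_chord_degenerate:
  assumes "a \<le> b" "b \<le> c" "c \<le> a + N"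
  shows "skein_chord a b c a = E b c" "skein_chord a b c c = E a b"
proof -
  have *: "E a b * E b c = E b c * E a b" "E b c * E a c = E a c * E b c"
    "E a b * E a c = E a c * E a b"
    using E_commute[of a b b c] E_commute[of a b c c] E_commute[of a a b c] assms by auto
  then show "skein_chord a b c a = E b c" "skein_chord a b c c = E a b"
    by (simp_all add: skein_chord_def skein_def qbr_commuting E_sym[of c] E_sym[of b a])
qed

end

section \<open>Quadrilateral and pentagon relations under rotation and reflection\<close>

locale chord_relations = chords +
  assumes quad_linear: "\<lbrakk>a < b; b < c; c < d; d < N\<rbrakk> \<Longrightarrow>
      E a c = skein (E b d) (skein_chord a b c d) (E a b) (E b c) (E c d) (E a d) \<and>
      E b d = skein (E a c) (skein_chord b c d a) (E b c) (E c d) (E a d) (E a b)"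
    and pent_linear: "\<lbrakk>a < b; b < c; c < d; d < e; e < N\<rbrakk> \<Longrightarrow> pent a b c d e \<and> pent e d c b a"
begin

text \<open>Moving d to the front turns each of the two equations into the other, so the induction
  has to carry both.\<close>

lemma quad:
  "\<lbrakk>a < b; b < c; c < d; d < a + N\<rbrakk> \<Longrightarrow>
      E a c = skein (E b d) (skein_chord a b c d) (E a b) (E b c) (E c d) (E a d) \<and>
      E b d = skein (E a c) (skein_chord b c d a) (E b c) (E c d) (E a d) (E a b)"
proof (induction "a + b + c + d" arbitrary: a b c d rule: less_induct)
  case less
  show ?case
  proof (cases "d < N")
    case True
    then show ?thesis using less.prems quad_linear by blast
  next
    case False
    let ?d = "d - N"
    have d: "E ?d x = E x d" "E x ?d = E x d" for x
      using False by (simp_all add: E_sub E_sym[of d x])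
    have sym: "E d a = E a d" "E c a = E a c" "E b a = E a b"
      by (simp_all add: E_sym)
    have comm: "E a b * E c d = E c d * E a b" "E b c * E a d = E a d * E b c"
      using E_commute[of a b c d] less.prems by auto
    have "skein_chord ?d a b c = skein_chord b c d a"
      by (simp add: skein_chord_def d sym skein_def comm)
    moreover have "skein_chord a b c ?d = skein_chord a b c d"
      by (simp add: skein_chord_def d)
    moreover have "E ?d b = skein (E a c) (skein_chord ?d a b c) (E ?d a) (E a b) (E b c) (E ?d c) \<and>
      E a c = skein (E ?d b) (skein_chord a b c ?d) (E a b) (E b c) (E ?d c) (E ?d a)"
      using less.prems False N_pos by (intro less.hyps) auto
    moreover have "skein x y s t u v = skein x y u v s t" for x y s t u v
      by (simp add: skein_def)
    ultimately show ?thesis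
      unfolding d by metis
  qed
qed

text \<open>The form in which the quadrilateral relations are applied: a chord bracketed twice with
  the diagonal crossing it is set free.\<close>

lemma quad_qbr:
  assumes "a < b" "b < c" "c < d" "d < a + N"
  shows "qbr (E a c) (qbr (E b d) (E a c)) =
      E b d + E a c * E a b * E c d + E a c * E b c * E a d - E a b * E a d - E b c * E c d"
    and "qbr (E b d) (qbr (E a c) (E b d)) =
      E a c + E b d * E a b * E c d + E b d * E b c * E a d - E a b * E b c - E c d * E a d"
proof -
  have s: "E b d = E d b" "E c a = E a c" "E d a = E a d" "E b a = E a b" by (simp_all add: E_sym)
  have comm: "E a c * E a b = E a b * E a c" "E a c * E b c = E b c * E a c"
    "E a c * E c d = E c d * E a c" "E a c * E a d = E a d * E a c"
    "E b d * E a b = E a b * E b d" "E b d * E b c = E b c * E b d"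
    "E b d * E c d = E c d * E b d" "E b d * E a d = E a d * E b d"
    "E a b * E c d = E c d * E a b" "E b c * E a d = E a d * E b c"
    "E a b * E a d = E a d * E a b" "E c d * E b c = E b c * E c d"
    using assms E_commute[of a a b c] E_commute[of a b c c] E_commute[of a c c d] E_commute[of a a c d]
      E_commute[of a b b d] E_commute[of b b c d] E_commute[of b c d d] E_commute[of a b d d]
      E_commute[of a b c d] E_commute[of a a b d] E_commute[of b c c d] by simp_all
  note q = quad[OF assms]
  have "qbr (E a c) (qbr (E b d) (E a c)) = E b d + E a c * E b c * E a d + E a c * E c d * E a b
      - E b c * E c d - E a d * E a b"
    using q comm s by (intro skein_flip) (simp_all add: skein_chord_def)
  then show "qbr (E a c) (qbr (E b d) (E a c)) =
      E b d + E a c * E a b * E c d + E a c * E b c * E a d - E a b * E a d - E b c * E c d"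
    using comm(9-12) by (simp add: mult.assoc)
  have "qbr (E b d) (qbr (E a c) (E b d)) = E a c + E b d * E a b * E c d + E b d * E b c * E a d
      - E a b * E b c - E c d * E a d"
    using q comm by (intro skein_flip) (simp_all add: skein_chord_def)
  then show "qbr (E b d) (qbr (E a c) (E b d)) =
      E a c + E b d * E a b * E c d + E b d * E b c * E a d - E a b * E b c - E c d * E a d" .
qed

lemma pent_rotate:
  assumes "a < b" "b < c" "c < d" "d < e" "e < a + N" and "pent a b c d e"
  shows "pent b c d e a"
proof -
  have comm: "E v w * E x y = E x y * E v w" "E x y * E v w = E v w * E x y"
    "E w x * E v y = E v y * E w x" "E v y * E w x = E w x * E v y"
    if "v \<le> w" "w \<le> x" "x \<le> y" "y \<le> v + N" for v w x y
    using E_commute[OF that] by auto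
  have quads:
    "qbr (E a c) (qbr (E b d) (E a c)) =
      E b d + E a c * E a b * E c d + E a c * E b c * E a d - E a b * E a d - E b c * E c d"
    "qbr (E a c) (qbr (E b e) (E a c)) =
      E b e + E a c * E a b * E c e + E a c * E b c * E a e - E a b * E a e - E b c * E c e"
    "qbr (E a d) (qbr (E b e) (E a d)) =
      E b e + E a d * E a b * E d e + E a d * E b d * E a e - E a b * E a e - E b d * E d e"
    "qbr (E a d) (qbr (E c e) (E a d)) =
      E c e + E a d * E a c * E d e + E a d * E c d * E a e - E a c * E a e - E c d * E d e"
    by (intro quad_qbr(1); use assms in linarith)+
  note pent = assms(6)[unfolded pent_def]
  have "qbr (qbr (E a d) (E c e)) (E b d) =
      - qbr (E a c) (E b e) + E c e * E a b + E c d * qbr (E a d) (E b e) + E d e * qbr (E a c) (E b d)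
      - E c d * E d e * E a b"
    by (rule pentagon_rotate[where bc = "E b c" and ae = "E a e"])
      (fact quads pent | rule comm; use assms in linarith)+
  then show ?thesis
    by (simp add: pent_def E_sym[of d a] E_sym[of c a] E_sym[of b a])
qed

lemma pent:
  "\<lbrakk>a < b; b < c; c < d; d < e; e < a + N\<rbrakk> \<Longrightarrow> pent a b c d e"
proof (induction "a + b + c + d + e" arbitrary: a b c d e rule: less_induct)
  case less
  show ?case
  proof (cases "e < N")
    case True
    then show ?thesis using less.prems pent_linear by blast
  next
    case False
    \<comment> \<open>The induction hypothesis covers the pentagon with its last vertex moved to the
      front; one application of \<open>pent_rotate\<close> brings that vertex back to the
      end.\<close>
    have "pent (e - N) a b c d"
      using less.prems False N_pos by (intro less.hyps) auto
    then have "pent a b c d (e - N)"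
      using less.prems False by (intro pent_rotate[of "e - N"]) auto
    then show ?thesis using False by (simp add: pent_def E_sub)
  qed
qed

text \<open>Reversing the vertices exchanges the two equations of \<open>quad_linear\<close> and the
  two orientations in \<open>pent_linear\<close>.\<close>

lemma reflect: "chord_relations \<alpha> N (\<lambda>i j. E (N - 1 - i mod N) (N - 1 - j mod N))"
proof -
  let ?E = "\<lambda>i j. E (N - 1 - i mod N) (N - 1 - j mod N)"
  interpret r: chords \<alpha> N ?E
  proof unfold_locales
    show "N > 0" by (rule N_pos)
    show "?E a b = ?E b a" for a b by (rule E_sym)
    show "?E a a = 1" for a by simp
    show "?E (a mod N) b = ?E a b" for a b by simp
    fix a b c d assume ord: "a \<le> b" "b \<le> c" "c \<le> d" "d < N"
    then show "?E a b * ?E c d = ?E c d * ?E a b \<and> ?E b c * ?E a d = ?E a d * ?E b c"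
      using E_commute_linear[of "N - 1 - d" "N - 1 - c" "N - 1 - b" "N - 1 - a"]
      by (simp add: E_sym)
  qed
  show ?thesis
  proof unfold_locales
    fix a b c d assume ord: "a < b" "b < c" "c < d" "d < N"
    define a' b' c' d' where "a' = N - 1 - a" and "b' = N - 1 - b" and "c' = N - 1 - c" and "d' = N - 1 - d"
    note defs = this
    have ord': "d' < c'" "c' < b'" "b' < a'" "a' < N" using ord by (auto simp: defs)
    have eqs: "?E a b = E b' a'" "?E a c = E c' a'" "?E a d = E d' a'" "?E b c = E c' b'" "?E b d = E d' b'" "?E c d = E d' c'"
      "?E b a = E b' a'" "?E c a = E c' a'" "?E d a = E d' a'"
      using ord E_sym unfolding defs by simp_all
    have comm: "E d' c' * E b' a' = E b' a' * E d' c'" "E c' b' * E d' a' = E d' a' * E c' b'"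
      "E b' a' * E c' b' = E c' b' * E b' a'" "E d' c' * E d' a' = E d' a' * E d' c'"
      "E d' c' * E c' b' = E c' b' * E d' c'" "E b' a' * E d' a' = E d' a' * E b' a'"
      using E_commute[of d' c' b' a'] E_commute[of c' b' b' a'] E_commute[of d' d' c' a'] E_commute[of d' c' c' b']
        E_commute[of d' b' a' a'] ord' by auto
    have sym: "E a' d' = E d' a'" "E b' d' = E d' b'" "E c' d' = E d' c'" "E a' c' = E c' a'" "E b' c' = E c' b'" "E a' b' = E b' a'"
      by (simp_all add: E_sym)
    show "?E a c = skein (?E b d) (r.skein_chord a b c d) (?E a b) (?E b c) (?E c d) (?E a d) \<and>
      ?E b d = skein (?E a c) (r.skein_chord b c d a) (?E b c) (?E c d) (?E a d) (?E a b)"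
      using quad[of d' c' b' a'] ord' unfolding r.skein_chord_def skein_chord_def eqs sym
      by (simp add: skein_def comm diff_diff_eq add.commute add.left_commute)
  next
    fix a b c d e assume ord: "a < b" "b < c" "c < d" "d < e" "e < N"
    then show "r.pent a b c d e \<and> r.pent e d c b a"
      using pent_linear[of "N - 1 - e" "N - 1 - d" "N - 1 - c" "N - 1 - b" "N - 1 - a"]
      unfolding r.pent_def pent_def by simp
  qed
qed

end

section \<open>Twists acting on chords\<close>

text \<open>The offset s lets one locale describe the polygon, with s = 0, and its mirror image,
  with s = 1; the vertex without a twist is N - 1 and 0, respectively. The predecessor of s + i is
  written s + i + N - 1 to avoid truncated subtraction.\<close>

locale twists = chord_relations +
  fixes s :: nat and R :: "nat \<Rightarrow> 'a \<Rightarrow> 'a"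
  assumes R_add: "R i (x + y) = R i x + R i y"
    and R_mult: "R i (x * y) = R i x * R i y"
    and R_one: "R i 1 = 1"
    and R_scalar: "R i \<alpha> = \<alpha>"
    and R_fix: "\<lbrakk>i < N - 1; a mod N \<noteq> (s + i) mod N; b mod N \<noteq> (s + i) mod N\<rbrakk> \<Longrightarrow>
      R i (E a b) = E a b"
    and R_move: "\<lbrakk>i < N - 1; c mod N \<noteq> (s + i) mod N\<rbrakk> \<Longrightarrow> R i (E (s + i) c) = skein_chord (s + i + N - 1) (s + i) (s + i + 1) c"
begin

lemma R_minus: "R i (- x) = - R i x"
proof -
  have "R i 0 = 0" using R_add[of i 0 0] by simp
  then have "R i x + R i (- x) = 0" using R_add[of i x "- x"] by simp
  then show ?thesis by (simp add: eq_neg_iff_add_eq_0 add.commute)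
qed

lemma R_diff: "R i (x - y) = R i x - R i y"
  using R_add[of i x "- y"] by (simp add: R_minus)

lemma R_qbr: "R i (qbr x y) = qbr (R i x) (R i y)"
  by (simp add: qbr_def R_add R_diff R_mult R_scalar)

lemma R_skein: "R i (skein x y a b c d) = skein (R i x) (R i y) (R i a) (R i b) (R i c) (R i d)"
  by (simp add: skein_def R_add R_diff R_minus R_qbr R_mult)

lemma R_move_Suc:
  assumes "i < N - 1" "Suc b mod N = (s + i) mod N" "x mod N \<noteq> Suc b mod N"
  shows "R i (E (Suc b) x) = skein_chord b (Suc b) (Suc (Suc b)) x" "R i (E x (Suc b)) = skein_chord b (Suc b) (Suc (Suc b)) x"
proof -
  have "(Suc b + (N - 1)) mod N = (s + i + (N - 1)) mod N" "Suc (Suc b) mod N = (s + i + 1) mod N"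
    using assms(2) by (metis mod_add_left_eq) (metis assms(2) mod_Suc_eq Suc_eq_plus1)
  moreover have "Suc b + (N - 1) = b + N" "s + i + (N - 1) = s + i + N - 1"
    using N_pos by auto
  ultimately have "skein_chord (s + i + N - 1) (s + i) (s + i + 1) x = skein_chord b (Suc b) (Suc (Suc b)) x"
    using assms(2) by (intro skein_chord_cong) simp_all
  moreover have "E (Suc b) x = E (s + i) x"
    using assms(2) by (intro E_cong) auto
  ultimately show "R i (E (Suc b) x) = skein_chord b (Suc b) (Suc (Suc b)) x"
    using R_move[OF assms(1)] assms(2,3) by simp
  then show "R i (E x (Suc b)) = skein_chord b (Suc b) (Suc (Suc b)) x"
    by (simp add: E_sym)
qed

lemma mod_neqI: "\<lbrakk>(x :: nat) < y; y < x + N\<rbrakk> \<Longrightarrow> x mod N \<noteq> y mod N" "\<lbrakk>x < y; y < x + N\<rbrakk> \<Longrightarrow> y mod N \<noteq> x mod N"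
  by (metis add_diff_cancel_left' dvd_imp_le less_imp_le_nat linorder_not_less mod_eq_dvd_iff_nat
      nat_add_left_cancel_less le_add_diff_inverse zero_less_diff)+

text \<open>A twist at the vertex b + 1 slides a crossing by one vertex. In general position this is
  the pentagon relation; if e meets the vertex b + 2 it is a quadrilateral relation, and if e meets
  a the crossing is a mere side.\<close>

lemma R_skein_chord:
  assumes i: "i < N - 1" "Suc b mod N = (s + i) mod N"
    and ord: "a < b" "Suc (Suc b) \<le> e" "e \<le> a + N"
  shows "R i (skein_chord a b (Suc b) e) = skein_chord a (Suc b) (Suc (Suc b)) e"
proof -
  define c d where "c = Suc b" and "d = Suc c"
  have cd: "Suc b = c" "Suc c = d" and ord: "a < b" "b < c" "c < d" "d \<le> e" "e \<le> a + N"
    using ord by (simp_all add: c_def d_def)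
  note ic = i(2)[unfolded cd]
  note move = R_move_Suc[OF i, unfolded cd]
  have comm: "E v w * E x y = E x y * E v w" "E x y * E v w = E v w * E x y"
    "E w x * E v y = E v y * E w x" "E v y * E w x = E w x * E v y"
    if "v \<le> w" "w \<le> x" "x \<le> y" "y \<le> v + N" for v w x y
    using E_commute[OF that] by auto
  have sym: "E d a = E a d" "E c a = E a c" "E b a = E a b" "E e a = E a e" "E e b = E b e"
    "E e c = E c e" "E e d = E d e"
    by (simp_all add: E_sym)
  have b: "b mod N \<noteq> (s + i) mod N"
    unfolding ic[symmetric] using ord by (intro mod_neqI) auto
  have bc: "R i (E b c) = E c d"
    using move(2)[of b] b ic skein_chord_degenerate(1)[of b c d] ord by simp
  consider "e = a + N" | "e = d" "e < a + N" | "d < e" "e < a + N"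
    using ord by linarith
  then have "R i (skein_chord a b c e) = skein_chord a c d e"
  proof cases
    case 1
    then have e: "skein_chord x y z e = skein_chord x y z a" for x y z
      by (intro skein_chord_cong) auto
    have "skein_chord a b c a = E b c" "skein_chord a c d a = E c d"
      using ord 1 by (intro skein_chord_degenerate(1); linarith)+
    then show ?thesis by (simp add: e bc)
  next
    case 2
    have fixed: "a mod N \<noteq> (s + i) mod N" "d mod N \<noteq> (s + i) mod N"
      unfolding ic[symmetric] using ord 2 mod_neqI(1)[of a c] mod_neqI(2)[of c d] by auto
    have "skein_chord b c d d = E b c"
      using ord 2 by (intro skein_chord_degenerate(2)) linarith+
    then have "R i (skein_chord a b c d) = skein (skein_chord b c d a) (E b d) (E a b) (E b c) (E c d) (E a d)"
      using bc fixed b i by (simp add: skein_chord_def[of a] R_skein R_fix move ic)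
    also have "\<dots> = qbr (E b d) (qbr (E a c) (E b d)) - E b d * E b c * E a d - E b d * E a b * E c d
        + E a b * E b c + E c d * E a d"
    proof -
      have *: "E a d * E b d = E b d * E a d" "E b c * E b d = E b d * E b c" "E a b * E b d = E b d * E a b"
        "E c d * E b d = E b d * E c d" "E c d * E a b = E a b * E c d"
        by (rule comm; use ord 2 in linarith)+
      have "E b c * E a d * E b d = E b d * E b c * E a d" "E c d * E a b * E b d = E b d * E a b * E c d"
        by (simp_all add: * mult.assoc) (simp_all add: * flip: mult.assoc)
      then show ?thesis
        by (simp add: skein_def skein_chord_def sym qbr_flip qbr_scale_left qbr_commuting *(1-4) mult.assoc)
    qed
    also have "\<dots> = E a c"
      using ord 2 by (subst quad_qbr(2)) auto
    also have "\<dots> = skein_chord a c d d"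
      using ord by (intro skein_chord_degenerate(2)[symmetric]) linarith+
    finally show ?thesis using 2 by simp
  next
    case 3
    have fixed: "a mod N \<noteq> (s + i) mod N" "e mod N \<noteq> (s + i) mod N"
      unfolding ic[symmetric] using ord 3 mod_neqI(1)[of a c] mod_neqI(2)[of c e] by auto
    \<comment> \<open>The pentagon is read in the cyclic order e, a, b, c, d, which is made
      increasing by adding N to all vertices but e.\<close>
    have pent: "qbr (qbr (E b d) (E a c)) (E b e) =
      - qbr (E a d) (E c e) + E a c * E d e + E a b * qbr (E b d) (E c e)
      + E b c * qbr (E a d) (E b e) - E a b * E b c * E d e"
      using pent[of e "a + N" "b + N" "c + N" "d + N"] 3 ord by (simp add: pent_def sym)
    have C: "E b c * E b e = E b e * E b c" "E c d * E b e = E b e * E c d" "E a b * E b e = E b e * E a b"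
      "E a d * E c d = E c d * E a d" "E c d * E a b = E a b * E c d"
      by (rule comm; use 3 ord in linarith)+
    have "R i (skein_chord a b c e) = skein (skein_chord b c d a) (E b e) (E a b) (skein_chord b c d e) (E c d) (E a e)"
      using bc fixed b i by (simp add: skein_chord_def[of a] R_skein R_fix move ic)
    also have "\<dots> = qbr (qbr (E b d) (E a c)) (E b e) - E b c * qbr (E a d) (E b e) - E a b * qbr (E b d) (E c e)
        + E a b * E b c * E d e + E c d * E a e"
    proof -
      have "E c d * E a b * E b e = E b e * (E c d * E a b)"
        by (metis C(2,3) mult.assoc)
      moreover have "E b e * (E c d * E a b) = E a b * (E c d * E b e)"
        by (metis C mult.assoc)
      ultimately show ?thesis
        by (simp add: skein_def skein_chord_def sym qbr_scale_left qbr_commuting C(1) algebra_simps)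
    qed
    also have "\<dots> = skein_chord a c d e"
      by (simp add: pent skein_chord_def skein_def)
    finally show ?thesis .
  qed
  then show ?thesis by (simp add: cd)
qed

section \<open>The product of all twists as a rotation\<close>

primrec sweep :: "nat \<Rightarrow> 'a \<Rightarrow> 'a" where
  "sweep 0 x = x"
| "sweep (Suc m) x = R m (sweep m x)"

text \<open>The three cases are the stages of a chord during the sweep: not yet reached, a crossing
  that is being slid along, and both ends moved back. Adding N to the ends provides a predecessor
  even for j = 0 and s = 0.\<close>

lemma sweep_linear_chord:
  assumes "j < k" "k < N" "m \<le> N - 1"
  shows "sweep m (E (s + N + j) (s + N + k)) =
    (if m \<le> j then E (s + N + j) (s + N + k)
     else if m < k then skein_chord (s + N + j - 1) (s + N + m - 1) (s + N + m) (s + N + k)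
     else E (s + N + j - 1) (s + N + k - 1))"
  using assms(3)
proof (induction m)
  case 0
  then show ?case by simp
next
  case (Suc m)
  define t where "t = s + N - 1"
  have t: "s + N = Suc t" using N_pos by (simp add: t_def)
  have "Suc (t + m) = s + m + N" using t by simp
  then have m: "m < N - 1" "Suc (t + m) mod N = (s + m) mod N"
    using Suc.prems mod_add_self2[of "s + m" N] by (linarith, metis)
  note IH = Suc.IH[unfolded t]
  consider "m < j" | "m = j" | "j < m" "m < k" | "k \<le> m"
    using linorder_less_linear[of m j] not_le[of k m] by blast
  then show ?case
  proof cases
    case 1
    then have "R m (E (Suc t + j) (Suc t + k)) = E (Suc t + j) (Suc t + k)"
      using assms m(1)
      by (intro R_fix[OF m(1)]; unfold m(2)[symmetric]; intro mod_neqI(2); linarith)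
    then show ?thesis using IH Suc.prems 1 by (simp add: t)
  next
    case 2
    have "(Suc t + k) mod N \<noteq> Suc (t + m) mod N"
      by (rule mod_neqI(2); use 2 assms in linarith)
    with m have "R m (E (Suc (t + m)) (Suc t + k)) =
        skein_chord (t + m) (Suc (t + m)) (Suc (Suc (t + m))) (Suc t + k)"
      by (rule R_move_Suc)
    moreover have "Suc m = k \<Longrightarrow>
        skein_chord (t + m) (Suc (t + m)) (Suc (Suc (t + m))) (Suc t + k) = E (t + m) (Suc (t + m))"
      using skein_chord_degenerate(2)[of "t + m" "Suc (t + m)" "Suc (Suc (t + m))"] assms by auto
    ultimately show ?thesis using IH Suc.prems 2 assms by (cases "Suc m = k") (auto simp: t)
  next
    case 3
    have "R m (skein_chord (t + j) (t + m) (Suc (t + m)) (Suc t + k)) =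
        skein_chord (t + j) (Suc (t + m)) (Suc (Suc (t + m))) (Suc t + k)"
      using m 3 assms by (intro R_skein_chord) auto
    moreover have "Suc m = k \<Longrightarrow> skein_chord (t + j) (Suc (t + m)) (Suc (Suc (t + m))) (Suc t + k) = E (t + j) (Suc (t + m))"
      using skein_chord_degenerate(2)[of "t + j" "Suc (t + m)" "Suc (Suc (t + m))"] 3 assms by auto
    ultimately show ?thesis using IH Suc.prems 3 assms by (cases "Suc m = k") (auto simp: t)
  next
    case 4
    \<comment> \<open>Both ends now lie behind the twists still to come; for j = 0 the lower end has
      become the vertex without a twist.\<close>
    have "R m (E (t + j) (t + k)) = E (t + j) (t + k)"
      using assms m(1) 4
      by (intro R_fix[OF m(1)]; unfold m(2)[symmetric]; intro mod_neqI(1); linarith)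
    then show ?thesis using IH Suc.prems 4 assms by (simp add: t)
  qed
qed

lemma sweep_hom:
  "sweep m 1 = 1"
  "sweep m (skein x y a b c d) =
    skein (sweep m x) (sweep m y) (sweep m a) (sweep m b) (sweep m c) (sweep m d)"
  by (induction m) (simp_all add: R_one R_skein)

lemma residue_offset: "\<exists>j<N. x mod N = (s + N + j) mod N"
proof (intro exI conjI)
  let ?j = "(x + (N - s mod N)) mod N"
  show "?j < N" using N_pos by simp
  have "s mod N < N" "s = N * (s div N) + s mod N" using N_pos by simp_all
  then have *: "s + N + (x + (N - s mod N)) = x + N * (s div N + 2)"
    unfolding distrib_left by linarith
  have "(s + N + ?j) mod N = (x + N * (s div N + 2)) mod N"
    unfolding mod_add_right_eq * ..
  then show "x mod N = (s + N + ?j) mod N"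
    by (simp only: mod_mult_self2)
qed

text \<open>Adding N - 1 stands for one step backwards modulo N. By symmetry of \<open>E\<close> it
  suffices to treat ends in increasing order, counted from s.\<close>

lemma sweep_chord: "sweep (N - 1) (E x y) = E (x + N - 1) (y + N - 1)"
proof -
  obtain j k where jk: "j < N" "k < N" "x mod N = (s + N + j) mod N" "y mod N = (s + N + k) mod N"
    using residue_offset by metis
  have shift: "(u + N - 1) mod N = (s + N + i - 1) mod N" if "u mod N = (s + N + i) mod N" for u i
  proof -
    have "(u + (N - 1)) mod N = (s + N + i + (N - 1)) mod N"
      using that by (metis mod_add_left_eq)
    also have "s + N + i + (N - 1) = (s + N + i - 1) + N" using N_pos by simp
    finally show ?thesis using N_pos by (simp only: mod_add_self2 Nat.add_diff_assoc Suc_leI One_nat_def)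
  qed
  have less: "sweep (N - 1) (E (s + N + i) (s + N + l)) = E (s + N + i - 1) (s + N + l - 1)"
    if "i < l" "l < N" for i l
    using that sweep_linear_chord[OF that, of "N - 1"] by auto
  have "sweep (N - 1) (E (s + N + j) (s + N + k)) = E (s + N + j - 1) (s + N + k - 1)"
    using less[of j k] less[of k j] jk by (metis E_refl E_sym linorder_neqE_nat sweep_hom(1))
  then show ?thesis
    using E_cong[OF jk(3,4)] E_cong[OF shift[OF jk(3)] shift[OF jk(4)]] by simp
qed

text \<open>Both sides expand to the same sum, as the brackets with x and y commute and the
  coefficients pass through them. The nine inner entries will be the chords from one vertex and its
  two neighbours to another vertex and its neighbours.\<close>

lemma skein_quadr_commute:
  assumes "x * y = y * x" "s1 * x = x * s1" "s2 * x = x * s2" "t1 * y = y * t1" "t2 * y = y * t2"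
    "t1 * s1 = s1 * t1" "t1 * s2 = s2 * t1" "t2 * s1 = s1 * t2" "t2 * s2 = s2 * t2"
  shows "skein x (skein y a s1 b s2 c) t1 (skein y a' s1 b' s2 c') t2 (skein y a'' s1 b'' s2 c'') =
    skein y (skein x a t1 a' t2 a'') s1 (skein x b t1 b' t2 b'') s2 (skein x c t1 c' t2 c'')"
proof -
  have "t * (s * z) = s * (t * z)" if "t * s = s * t" for s t z :: 'a
    by (metis that mult.assoc)
  note L = this[OF assms(6)] this[OF assms(7)] this[OF assms(8)] this[OF assms(9)]
  show ?thesis
    by (simp add: skein_def qbr_scale_right assms(2-5) qbr_left_commute[OF assms(1)] L algebra_simps)
qed

lemma R_commute:
  assumes "Suc i < j" "j < N - 1"
  shows "R i (R j (E x y)) = R j (R i (E x y))"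
proof -
  \<comment> \<open>The twisted vertices are p1 and q1, the others are their neighbours. N is added
    so that predecessors exist; p2 = q0 and q2 = p0 + N may occur.\<close>
  define p0 p1 p2 q0 q1 q2 where
    "p0 = s + N + i - 1" and "p1 = Suc p0" and "p2 = Suc p1" and
    "q0 = s + N + j - 1" and "q1 = Suc q0" and "q2 = Suc q1"
  have ij: "i < N - 1" "j < N - 1" using assms by simp_all
  have eq: "p1 = s + i + N" "q1 = s + j + N"
    using N_pos by (simp_all add: p0_def p1_def q0_def q1_def)
  then have res: "p1 mod N = (s + i) mod N" "q1 mod N = (s + j) mod N"
    by (simp_all only: mod_add_self2)
  have ord: "p0 < p1" "p1 < p2" "p2 \<le> q0" "q0 < q1" "q1 < q2" "q2 \<le> p0 + N"
    using assms eq by (auto simp: p1_def p2_def q1_def q2_def)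
  have fix_i: "R i (E u v) = E u v" if "u mod N \<noteq> p1 mod N" "v mod N \<noteq> p1 mod N" for u v
    using R_fix[OF ij(1)] that res by simp
  have fix_j: "R j (E u v) = E u v" if "u mod N \<noteq> q1 mod N" "v mod N \<noteq> q1 mod N" for u v
    using R_fix[OF ij(2)] that res by simp
  have move: "v mod N \<noteq> p1 mod N \<Longrightarrow> R i (E p1 v) = skein_chord p0 p1 p2 v"
    "v mod N \<noteq> p1 mod N \<Longrightarrow> R i (E v p1) = skein_chord p0 p1 p2 v"
    "v mod N \<noteq> q1 mod N \<Longrightarrow> R j (E q1 v) = skein_chord q0 q1 q2 v"
    "v mod N \<noteq> q1 mod N \<Longrightarrow> R j (E v q1) = skein_chord q0 q1 q2 v" for v
    using R_move_Suc[of i p0 v] R_move_Suc[of j q0 v] ij res by (simp_all add: p1_def p2_def q1_def q2_def)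
  have ne: "p0 mod N \<noteq> p1 mod N" "p2 mod N \<noteq> p1 mod N" "q0 mod N \<noteq> p1 mod N" "q1 mod N \<noteq> p1 mod N"
    "q2 mod N \<noteq> p1 mod N" "p0 mod N \<noteq> q1 mod N" "p1 mod N \<noteq> q1 mod N" "p2 mod N \<noteq> q1 mod N"
    "q0 mod N \<noteq> q1 mod N" "q2 mod N \<noteq> q1 mod N"
    by ((rule mod_neqI(1); use ord in linarith) | (rule mod_neqI(2); use ord in linarith))+
  \<comment> \<open>The only chord that both twists move. For every other chord, one twist fixes it
    together with all chords in its image under the other twist.\<close>
  have both: "R i (R j (E p1 q1)) = R j (R i (E p1 q1))"
  proof -
    have "skein (E q0 q2) (skein (E p0 p2) (E p1 q1) (E p0 p1) (E p2 q1) (E p1 p2) (E p0 q1))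
        (E q0 q1) (skein (E p0 p2) (E p1 q2) (E p0 p1) (E p2 q2) (E p1 p2) (E p0 q2))
        (E q1 q2) (skein (E p0 p2) (E p1 q0) (E p0 p1) (E p2 q0) (E p1 p2) (E p0 q0)) =
      skein (E p0 p2) (skein (E q0 q2) (E p1 q1) (E q0 q1) (E p1 q2) (E q1 q2) (E p1 q0))
        (E p0 p1) (skein (E q0 q2) (E p2 q1) (E q0 q1) (E p2 q2) (E q1 q2) (E p2 q0))
        (E p1 p2) (skein (E q0 q2) (E p0 q1) (E q0 q1) (E p0 q2) (E q1 q2) (E p0 q0))"
    proof -
      have comm: "E a b * E c d = E c d * E a b" "E c d * E a b = E a b * E c d"
        if "p0 \<le> a" "a \<le> b" "b \<le> p2" "q0 \<le> c" "c \<le> d" "d \<le> q2" for a b c d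
        using E_commute[of a b c d] that ord by auto
      show ?thesis
        by (rule skein_quadr_commute; rule comm; use ord in linarith)
    qed
    moreover have "E q1 u = E u q1" "E q2 u = E u q2" "E q0 u = E u q0" if "u \<in> {p0, p1, p2}" for u
      by (simp_all add: E_sym)
    ultimately show ?thesis
      by (simp add: move skein_chord_def R_skein fix_i fix_j ne)
  qed
  have one: "R i (R j (E u v)) = R j (R i (E u v))" if "u mod N = p1 mod N" for u v
  proof -
    have u: "E u v = E p1 v" using that by (intro E_cong) auto
    consider "v mod N = q1 mod N" | "v mod N = p1 mod N" | "v mod N \<noteq> q1 mod N" "v mod N \<noteq> p1 mod N"
      by blast
    then show ?thesis
    proof cases
      case 1
      then have "E p1 v = E p1 q1" by (intro E_cong) auto
      then show ?thesis using both u by simp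
    next
      case 2
      then have "E p1 v = E v v" by (intro E_cong) auto
      then show ?thesis using u by (simp add: R_one)
    next
      case 3
      then show ?thesis unfolding u by (simp add: move skein_chord_def R_skein fix_i fix_j ne)
    qed
  qed
  have other: "R i (R j (E u v)) = R j (R i (E u v))"
    if "u mod N = q1 mod N" "v mod N \<noteq> p1 mod N" for u v
  proof -
    have u: "E u v = E q1 v" using that by (intro E_cong) auto
    show ?thesis
    proof (cases "v mod N = q1 mod N")
      case True
      then have "E q1 v = E v v" by (intro E_cong) auto
      then show ?thesis using u by (simp add: R_one)
    next
      case False
      then show ?thesis unfolding u using that by (simp add: move skein_chord_def R_skein fix_i fix_j ne)
    qed
  qed
  show ?thesis
    using one[of x y] one[of y x] other[of x y] other[of y x] fix_i[of x y] fix_j[of x y]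
    by (metis E_sym)
qed

text \<open>The rotation carries the vertex of \<open>R (Suc i)\<close> and its neighbours to the
  vertex of \<open>R i\<close> and its neighbours, and the moving rule has the same form at
  both.\<close>

lemma sweep_R:
  assumes "Suc i < N - 1"
  shows "sweep (N - 1) (R (Suc i) (E x y)) = R i (sweep (N - 1) (E x y))"
proof -
  have i: "i < N - 1" using assms by simp
  define b where "b = s + i"
  define b' where "b' = b + N - 1"
  have b': "Suc b' = b + N" using N_pos by (simp add: b'_def)
  then have res: "Suc b mod N = (s + Suc i) mod N" "Suc b' mod N = (s + i) mod N"
    by (simp_all add: b_def)
  have residue: "(u + N - 1) mod N \<noteq> (s + i) mod N" if "u mod N \<noteq> (s + Suc i) mod N" for u
  proof
    assume "(u + N - 1) mod N = (s + i) mod N"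
    then have "Suc (u + N - 1) mod N = Suc (s + i) mod N" by (metis mod_Suc_eq)
    then show False using that N_pos by simp
  qed
  have move: "sweep (N - 1) (R (Suc i) (E u v)) = R i (sweep (N - 1) (E u v))"
    if "u mod N = (s + Suc i) mod N" for u v
  proof (cases "v mod N = (s + Suc i) mod N")
    case True
    then have "E u v = E v v" using that by (intro E_cong) auto
    then show ?thesis by (simp add: R_one sweep_hom)
  next
    case False
    then have v: "v mod N \<noteq> Suc b mod N" "(v + N - 1) mod N \<noteq> Suc b' mod N"
      using residue[of v] res by simp_all
    have u: "E u v = E (Suc b) v" using that res by (intro E_cong) auto
    have shift: "b + N - 1 = b'" "Suc b + N - 1 = Suc b'" "Suc (Suc b) + N - 1 = Suc (Suc b')"
      using N_pos by (simp_all add: b'_def)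
    have "sweep (N - 1) (R (Suc i) (E (Suc b) v)) = skein_chord b' (Suc b') (Suc (Suc b')) (v + N - 1)"
      unfolding R_move_Suc(1)[OF assms res(1) v(1)] skein_chord_def sweep_hom sweep_chord shift ..
    also have "\<dots> = R i (sweep (N - 1) (E (Suc b) v))"
      unfolding sweep_chord shift R_move_Suc(1)[OF i res(2) v(2)] ..
    finally show ?thesis using u by simp
  qed
  show ?thesis
  proof (cases "x mod N = (s + Suc i) mod N \<or> y mod N = (s + Suc i) mod N")
    case True
    then show ?thesis using move by (metis E_sym)
  next
    case False
    then have "R (Suc i) (E x y) = E x y"
      using assms by (intro R_fix) auto
    moreover have "R i (E (x + N - 1) (y + N - 1)) = E (x + N - 1) (y + N - 1)"
      using False residue i by (intro R_fix) auto
    ultimately show ?thesis by (simp only: sweep_chord)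
  qed
qed

text \<open>The mirror image of the vertex N - 2 - i is 1 + i, whence the offset 1 and the reversed
  numbering. Reflection interchanges the neighbours of the twisted vertex, which only swaps the two
  product terms in its \<open>skein_chord\<close>.\<close>

lemma twists_reflect:
  assumes s: "s = 0" and N: "N > 1"
  shows "twists \<alpha> N (\<lambda>i j. E (N - 1 - i mod N) (N - 1 - j mod N)) 1 (\<lambda>i. R (N - 2 - i))"
proof -
  let ?E = "\<lambda>i j. E (N - 1 - i mod N) (N - 1 - j mod N)"
  interpret r: chord_relations \<alpha> N ?E by (rule reflect)
  have swap: "skein x y p1 p2 p3 p4 = skein x y p3 p4 p1 p2" for x y p1 p2 p3 p4
    by (simp add: skein_def)
  show ?thesis
  proof unfold_locales
    fix i assume i: "i < N - 1"
    define v where "v = N - 2 - i"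
    have v: "v < N - 1" "N - 1 - (1 + i) mod N = v" using i by (auto simp: v_def)
    have residue: "(N - 1 - a mod N) mod N \<noteq> v mod N" if "a mod N \<noteq> (1 + i) mod N" for a
    proof -
      have lt: "a mod N < N" "(1 + i) mod N = 1 + i" using N i by auto
      then have "N - 1 - a mod N \<noteq> v" using that i unfolding v_def by linarith
      moreover have "(N - 1 - a mod N) mod N = N - 1 - a mod N" "v mod N = v"
        using N v(1) by auto
      ultimately show ?thesis by simp
    qed
    show "R (N - 2 - i) (?E a b) = ?E a b"
      if "a mod N \<noteq> (1 + i) mod N" "b mod N \<noteq> (1 + i) mod N" for a b
    proof -
      show ?thesis using R_fix[of v "N - 1 - a mod N" "N - 1 - b mod N"] residue that v s by (simp add: v_def)
    qed
    show "R (N - 2 - i) (?E (1 + i) c) = r.skein_chord (1 + i + N - 1) (1 + i) (1 + i + 1) c"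
      if c: "c mod N \<noteq> (1 + i) mod N" for c
    proof -
      let ?c = "N - 1 - c mod N"
      have "R v (E v ?c) = skein_chord (v + N - 1) v (v + 1) ?c"
        using R_move[of v ?c] residue[OF c] v s by simp
      moreover have "skein_chord (v + N - 1) v (v + 1) ?c = r.skein_chord (1 + i + N - 1) (1 + i) (1 + i + 1) c"
      proof -
        have "(1 + i + N - 1) mod N = i" using i by simp
        then have lo: "N - 1 - (1 + i + N - 1) mod N = v + 1" using i by (simp add: v_def)
        \<comment> \<open>For i = N - 2 the index wraps around: then v = 0, whose predecessor is N -
          1.\<close>
        have hi: "(N - 1 - (1 + i + 1) mod N) mod N = (v + N - 1) mod N"
        proof (cases "i = N - 2")
          case True
          then have "1 + i + 1 = N" "v = 0" using N by (auto simp: v_def)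
          then show ?thesis using N by simp
        next
          case False
          then have "v > 0" using i by (simp add: v_def)
          then have shift: "v + N - 1 = v - 1 + N" by simp
          have "(1 + i + 1) mod N = 1 + i + 1" using False i by simp
          then have "N - 1 - (1 + i + 1) mod N = v - 1" using i unfolding v_def by linarith
          then show ?thesis unfolding shift mod_add_self2 by (rule arg_cong)
        qed
        have "r.skein_chord (1 + i + N - 1) (1 + i) (1 + i + 1) c = skein_chord (v + 1) v (N - 1 - (1 + i + 1) mod N) ?c"
          unfolding r.skein_chord_def skein_chord_def lo v(2) ..
        also have "\<dots> = skein_chord (v + 1) v (v + N - 1) ?c"
          using hi by (intro skein_chord_cong) auto
        also have "\<dots> = skein_chord (v + N - 1) v (v + 1) ?c"
          unfolding skein_chord_def by (subst swap) (simp add: E_sym)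
        finally show ?thesis by simp
      qed
      ultimately show ?thesis using v by (simp add: v_def)
    qed
  qed (simp_all add: R_add R_mult R_one R_scalar)
qed

end

section \<open>Half twists in a group\<close>

context monoid
begin

lemma mprod_closed [simp, intro]: "set xs \<subseteq> carrier G \<Longrightarrow> mprod G xs \<in> carrier G"
  by (induction xs) (auto simp: mprod_def)

lemma mprod_Nil [simp]: "mprod G [] = \<one>"
  by (simp add: mprod_def)

lemma mprod_Cons [simp]: "mprod G (x # xs) = x \<otimes> mprod G xs"
  by (simp add: mprod_def)

lemma mprod_append:
  "set xs \<subseteq> carrier G \<Longrightarrow> set ys \<subseteq> carrier G \<Longrightarrow> mprod G (xs @ ys) = mprod G xs \<otimes> mprod G ys"
  by (induction xs) (simp_all add: m_assoc mprod_closed)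

lemma mprod_intertwine:
  assumes "x \<in> carrier G" "\<And>i. i \<in> set is \<Longrightarrow> f i \<in> carrier G \<and> g i \<in> carrier G \<and> x \<otimes> f i = g i \<otimes> x"
  shows "x \<otimes> mprod G (map f is) = mprod G (map g is) \<otimes> x"
  using assms(2)
proof (induction "is")
  case Nil
  then show ?case using assms(1) by simp
next
  case (Cons i "is")
  then have c: "f i \<in> carrier G" "g i \<in> carrier G" "x \<otimes> f i = g i \<otimes> x"
    "mprod G (map f is) \<in> carrier G" "mprod G (map g is) \<in> carrier G"
    by (auto intro!: mprod_closed)
  have "x \<otimes> (f i \<otimes> mprod G (map f is)) = g i \<otimes> (x \<otimes> mprod G (map f is))"
    using c assms(1) by (metis m_assoc)
  then show ?case using c assms(1) Cons by (simp add: m_assoc)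
qed

end

lemma (in group) inv_mprod:
  "set xs \<subseteq> carrier G \<Longrightarrow> inv (mprod G xs) = mprod G (map (m_inv G) (rev xs))"
proof (induction xs)
  case (Cons x xs)
  then have "mprod G (map (m_inv G) (rev xs) @ [inv x]) = mprod G (map (m_inv G) (rev xs)) \<otimes> mprod G [inv x]"
    by (intro mprod_append) auto
  then show ?case using Cons by (simp add: inv_mult_group mprod_closed)
qed simp

locale generated_family = group G for G (structure) +
  fixes n :: nat and \<rho> :: "nat \<Rightarrow> 'a"
  assumes closed: "i < n \<Longrightarrow> \<rho> i \<in> carrier G"
begin

lemma upt_split: "a \<le> b \<Longrightarrow> b \<le> m \<Longrightarrow> [a..<m] = [a..<b] @ [b..<m]"
  by (metis le_add_diff_inverse upt_add_eq_append)

text \<open>Bounds are half-open here and in the next two definitions: the generators a, ..., m - 1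
  occur, so \<open>half_twist a m\<close> is \<open>\<Delta>\<close> from a to m - 1. The Coxeter
  element is \<open>desc 0 n\<close>.\<close>

definition desc :: "nat \<Rightarrow> nat \<Rightarrow> 'a" where "desc a m = mprod G (map \<rho> (rev [a..<m]))"
definition asc :: "nat \<Rightarrow> nat \<Rightarrow> 'a" where "asc a m = mprod G (map \<rho> [a..<m])"
definition half_twist :: "nat \<Rightarrow> nat \<Rightarrow> 'a" where "half_twist a m = mprod G (map (\<lambda>k. desc a (Suc k)) [a..<m])"

lemma desc_closed [simp, intro]: "m \<le> n \<Longrightarrow> desc a m \<in> carrier G"
  by (auto simp: desc_def intro!: mprod_closed closed)

lemma asc_closed [simp, intro]: "m \<le> n \<Longrightarrow> asc a m \<in> carrier G"
  by (auto simp: asc_def intro!: mprod_closed closed)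

lemma half_twist_closed [simp, intro]: "m \<le> n \<Longrightarrow> half_twist a m \<in> carrier G"
  by (auto simp: half_twist_def intro!: mprod_closed)

lemma empty [simp]: "desc a a = \<one>" "asc a a = \<one>" "half_twist a a = \<one>"
  by (simp_all add: desc_def asc_def half_twist_def)

lemma desc_append: "a \<le> b \<Longrightarrow> b \<le> m \<Longrightarrow> m \<le> n \<Longrightarrow> desc a m = desc b m \<otimes> desc a b"
  by (simp add: desc_def upt_split[of a b m])
    (intro mprod_append; auto intro!: closed)

lemma desc_Suc: "a \<le> m \<Longrightarrow> m < n \<Longrightarrow> desc a (Suc m) = \<rho> m \<otimes> desc a m"
  by (simp add: desc_def)

lemma desc_Suc_left: "a < m \<Longrightarrow> m \<le> n \<Longrightarrow> desc a m = desc (Suc a) m \<otimes> \<rho> a"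
  using desc_append[of a "Suc a" m] by (simp add: desc_Suc closed)

lemma asc_Suc: "a \<le> m \<Longrightarrow> m < n \<Longrightarrow> asc a (Suc m) = asc a m \<otimes> \<rho> m"
  by (simp add: asc_def) (subst mprod_append; auto simp: closed)

lemma asc_Suc_left: "a < m \<Longrightarrow> asc a m = \<rho> a \<otimes> asc (Suc a) m"
  by (simp add: asc_def upt_conv_Cons)

lemma half_twist_Suc: "a \<le> m \<Longrightarrow> m < n \<Longrightarrow> half_twist a (Suc m) = half_twist a m \<otimes> desc a (Suc m)"
  by (simp add: half_twist_def) (subst mprod_append; auto)

lemma \<Delta>_eq_ht: "\<Delta> G \<rho> a b = half_twist a (Suc b)"
  by (simp add: \<Delta>_def half_twist_def desc_def)

text \<open>Giving one factor of the square of \<open>\<rho> 0\<close> to each neighbouring product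
  turns the long relation into a statement about the Coxeter element and its reverse.\<close>

lemma sphere_relations_iff:
  assumes "n > 1"
  shows "sphere_relations G \<rho> n \<longleftrightarrow>
    half_twist 1 n \<otimes> half_twist 1 n = \<one> \<and> desc 0 n \<otimes> asc 0 n = \<one>"
proof -
  have "desc 1 n \<otimes> \<rho> 0 [^] (2::nat) \<otimes> asc 1 n = desc 0 n \<otimes> asc 0 n"
    using assms closed[of 0] desc_Suc_left[of 0 n] asc_Suc_left[of 0 n]
    by (simp add: m_assoc numeral_2_eq_2)
  then show ?thesis
    using assms by (simp add: sphere_relations_def \<Delta>_eq_ht desc_def asc_def numeral_2_eq_2)
qed

lemma half_twist_relations_iff:
  assumes "n > 1"
  shows "half_twist_relations G \<rho> n \<longleftrightarrow> half_twist 0 n \<otimes> half_twist 0 n = \<one> \<and>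
    half_twist 0 (n - 1) \<otimes> half_twist 0 (n - 1) = \<one> \<and> half_twist 1 n \<otimes> half_twist 1 n = \<one>"
  using assms by (simp add: half_twist_relations_def \<Delta>_eq_ht numeral_2_eq_2 Suc_diff_Suc)

end

text \<open>Kept apart from the braid relations, since for the twists those are derived from
  commutation and conjugation by the rotation.\<close>

locale commuting_family = generated_family +
  assumes commute: "Suc i < j \<Longrightarrow> j < n \<Longrightarrow> \<rho> i \<otimes> \<rho> j = \<rho> j \<otimes> \<rho> i"
begin

lemma desc_commute:
  assumes "m < j" "j < n"
  shows "\<rho> j \<otimes> desc a m = desc a m \<otimes> \<rho> j"
  unfolding desc_def using assms
  by (intro mprod_intertwine) (auto simp: closed commute[symmetric])

lemma desc_commute_low:
  assumes "Suc j < a" "m \<le> n" "j < n"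
  shows "\<rho> j \<otimes> desc a m = desc a m \<otimes> \<rho> j"
  unfolding desc_def using assms
  by (intro mprod_intertwine) (auto simp: closed commute)

lemma asc_commute:
  assumes "m < j" "j < n"
  shows "\<rho> j \<otimes> asc a m = asc a m \<otimes> \<rho> j"
  unfolding asc_def using assms
  by (intro mprod_intertwine) (auto simp: closed commute[symmetric])

lemma half_twist_commute:
  assumes "m < j" "j < n"
  shows "\<rho> j \<otimes> half_twist a m = half_twist a m \<otimes> \<rho> j"
  unfolding half_twist_def using assms
  by (intro mprod_intertwine) (auto simp: closed desc_commute)

text \<open>
  Cancelling in \<open>desc 0 n \<otimes> \<rho> (a + 1) = \<rho> a \<otimes> desc 0 n\<close> the factors that commute with the generator involved
  leaves the braid relation of \<open>\<rho> a\<close> and \<open>\<rho> (a + 1)\<close>.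
\<close>

lemma braid_relations_if_shift:
  assumes "\<And>i. Suc i < n \<Longrightarrow> desc 0 n \<otimes> \<rho> (Suc i) = \<rho> i \<otimes> desc 0 n"
  shows "braid_relations G \<rho> n"
proof -
  have "\<rho> a \<otimes> \<rho> (Suc a) \<otimes> \<rho> a = \<rho> (Suc a) \<otimes> \<rho> a \<otimes> \<rho> (Suc a)" if a: "Suc a < n" for a
  proof -
    let ?u = "desc (Suc (Suc a)) n" and ?v = "desc 0 a"
    have c: "?u \<in> carrier G" "?v \<in> carrier G" "\<rho> a \<in> carrier G" "\<rho> (Suc a) \<in> carrier G"
      using a by (auto intro: closed)
    have eq: "desc 0 n = ?u \<otimes> (\<rho> (Suc a) \<otimes> (\<rho> a \<otimes> ?v))"
      using a desc_append[of 0 "Suc (Suc a)" n] by (simp add: desc_Suc)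
    have "?u \<otimes> (\<rho> (Suc a) \<otimes> \<rho> a \<otimes> \<rho> (Suc a)) \<otimes> ?v = desc 0 n \<otimes> \<rho> (Suc a)"
      using desc_commute[of a "Suc a" 0] a c by (simp add: eq m_assoc)
    also have "\<dots> = \<rho> a \<otimes> desc 0 n"
      using a by (rule assms)
    also have "\<dots> = ?u \<otimes> (\<rho> a \<otimes> \<rho> (Suc a) \<otimes> \<rho> a) \<otimes> ?v"
      using desc_commute_low[of a "Suc (Suc a)" n] a c unfolding eq by (simp flip: m_assoc)
    finally show ?thesis using c by simp
  qed
  then show ?thesis by (auto simp: braid_relations_def intro: commute)
qed

end

section \<open>Half twists and powers of the Coxeter element under the braid relations\<close>

locale braid_family = generated_family +
  assumes braid_relations: "braid_relations G \<rho> n"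

sublocale braid_family \<subseteq> commuting_family
  using braid_relations by unfold_locales (auto simp: braid_relations_def)

context braid_family
begin

lemma braid: "Suc a < n \<Longrightarrow> \<rho> a \<otimes> (\<rho> (Suc a) \<otimes> \<rho> a) = \<rho> (Suc a) \<otimes> (\<rho> a \<otimes> \<rho> (Suc a))"
  using braid_relations closed by (simp add: braid_relations_def m_assoc)

text \<open>The generator \<open>\<rho> (Suc i)\<close> passes the factors below i, the braid
  relation turns it into \<open>\<rho> i\<close>, and this passes the factors above i + 1.\<close>

lemma desc_shift:
  assumes "a \<le> i" "Suc i < m" "m \<le> n"
  shows "desc a m \<otimes> \<rho> (Suc i) = \<rho> i \<otimes> desc a m"
proof -
  have Suc_less_n: "Suc i < n" using assms by simp
  let ?u = "desc (Suc (Suc i)) m" and ?v = "desc a i"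
  have c: "?u \<in> carrier G" "?v \<in> carrier G" "\<rho> i \<in> carrier G" "\<rho> (Suc i) \<in> carrier G"
    using assms by (auto intro: closed)
  have eq: "desc a m = ?u \<otimes> (\<rho> (Suc i) \<otimes> (\<rho> i \<otimes> ?v))"
    using assms desc_append[of a "Suc (Suc i)" m] by (simp add: desc_Suc)
  have "desc a m \<otimes> \<rho> (Suc i) = ?u \<otimes> (\<rho> (Suc i) \<otimes> (\<rho> i \<otimes> \<rho> (Suc i))) \<otimes> ?v"
    using desc_commute[of i "Suc i" a] assms c by (simp add: eq m_assoc)
  also have "\<dots> = \<rho> i \<otimes> ?u \<otimes> (\<rho> (Suc i) \<otimes> \<rho> i) \<otimes> ?v"
    using desc_commute_low[of i "Suc (Suc i)" m] assms c unfolding braid[of i, symmetric, OF Suc_less_n]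
    by (simp flip: m_assoc)
  also have "\<dots> = \<rho> i \<otimes> desc a m"
    using c by (simp add: eq m_assoc)
  finally show ?thesis .
qed

lemma desc_desc_shift:
  assumes "a \<le> b" "j < m" "m \<le> n"
  shows "desc a m \<otimes> desc (Suc b) (Suc j) = desc b j \<otimes> desc a m"
proof -
  have "desc (Suc b) (Suc j) = mprod G (map (\<lambda>i. \<rho> (Suc i)) (rev [b..<j]))"
    by (simp add: desc_def rev_map map_Suc_upt[symmetric] comp_def del: upt_Suc)
  then show ?thesis
    unfolding desc_def[of b j] using assms
    by (auto intro!: mprod_intertwine closed desc_shift)
qed

lemma asc_shift:
  assumes "a \<le> i" "Suc i < m" "m \<le> n"
  shows "asc a m \<otimes> \<rho> i = \<rho> (Suc i) \<otimes> asc a m"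
proof -
  have Suc_less_n: "Suc i < n" using assms by simp
  let ?u = "asc (Suc (Suc i)) m" and ?v = "asc a i"
  have c: "?u \<in> carrier G" "?v \<in> carrier G" "\<rho> i \<in> carrier G" "\<rho> (Suc i) \<in> carrier G"
    using assms by (auto intro: closed)
  have u: "\<rho> i \<otimes> ?u = ?u \<otimes> \<rho> i"
    unfolding asc_def using assms by (intro mprod_intertwine) (auto simp: closed commute)
  have v: "\<rho> (Suc i) \<otimes> ?v = ?v \<otimes> \<rho> (Suc i)"
    using assms by (intro asc_commute) auto
  have "[a..<m] = [a..<i] @ i # Suc i # [Suc (Suc i)..<m]"
    using assms upt_split[of a i m] by (simp add: upt_conv_Cons)
  then have eq: "asc a m = ?v \<otimes> (\<rho> i \<otimes> (\<rho> (Suc i) \<otimes> ?u))"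
    using assms unfolding asc_def by (simp, subst mprod_append) (auto intro!: closed)
  have "asc a m \<otimes> \<rho> i = ?v \<otimes> (\<rho> i \<otimes> (\<rho> (Suc i) \<otimes> \<rho> i)) \<otimes> ?u"
    using u c by (simp add: eq m_assoc)
  also have "\<dots> = \<rho> (Suc i) \<otimes> ?v \<otimes> (\<rho> i \<otimes> \<rho> (Suc i)) \<otimes> ?u"
    using v c unfolding braid[OF Suc_less_n] by (simp flip: m_assoc)
  also have "\<dots> = \<rho> (Suc i) \<otimes> asc a m"
    using c by (simp add: eq m_assoc)
  finally show ?thesis .
qed

text \<open>Moving the last factor \<open>desc a (Suc l)\<close> to the front raises all indices of
  the other factors by one.\<close>

lemma half_twist_Suc_left:
  assumes "a \<le> l" "l < n"
  shows "half_twist a (Suc l) = desc a (Suc l) \<otimes> half_twist (Suc a) (Suc l)"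
proof -
  have "half_twist (Suc a) (Suc l) = mprod G (map (\<lambda>k. desc (Suc a) (Suc (Suc k))) [a..<l])"
    by (simp add: half_twist_def map_Suc_upt[symmetric] comp_def del: upt_Suc)
  moreover have "desc a (Suc l) \<otimes> mprod G (map (\<lambda>k. desc (Suc a) (Suc (Suc k))) [a..<l]) =
      half_twist a l \<otimes> desc a (Suc l)"
    unfolding half_twist_def using assms by (intro mprod_intertwine) (auto intro!: desc_desc_shift)
  ultimately show ?thesis using assms by (simp add: half_twist_Suc)
qed

text \<open>This collects the leading letters of the factors in front. Once the earlier ones are
  there, the remaining \<open>half_twist a l\<close> has only generators below l and lets
  \<open>\<rho> (Suc l)\<close> pass.\<close>

lemma half_twist_Suc_asc: "a \<le> l \<Longrightarrow> l < n \<Longrightarrow> half_twist a (Suc l) = asc a (Suc l) \<otimes> half_twist a l"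
proof (induction l rule: dec_induct)
  case base
  then show ?case by (simp add: half_twist_Suc desc_Suc asc_Suc closed)
next
  case (step l)
  have "half_twist a (Suc (Suc l)) = asc a (Suc l) \<otimes> half_twist a l \<otimes> (\<rho> (Suc l) \<otimes> desc a (Suc l))"
    using step by (simp add: half_twist_Suc[of a "Suc l"] desc_Suc[of a "Suc l"])
  also have "\<dots> = asc a (Suc l) \<otimes> (\<rho> (Suc l) \<otimes> half_twist a l) \<otimes> desc a (Suc l)"
    using step by (simp add: half_twist_commute m_assoc closed)
  also have "\<dots> = asc a (Suc (Suc l)) \<otimes> half_twist a (Suc l)"
    using step by (simp add: asc_Suc[of a "Suc l"] half_twist_Suc m_assoc closed)
  finally show ?case .
qed

lemma half_twist_Suc_left_asc:
  assumes "a \<le> l" "l < n"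
  shows "half_twist a (Suc l) = half_twist (Suc a) (Suc l) \<otimes> asc a (Suc l)"
proof -
  have "asc a (Suc l) \<otimes> desc a (Suc k) = desc (Suc a) (Suc (Suc k)) \<otimes> asc a (Suc l)" if "k < l" for k
  proof -
    have "desc (Suc a) (Suc (Suc k)) = mprod G (map (\<lambda>i. \<rho> (Suc i)) (rev [a..<Suc k]))"
      by (simp add: desc_def rev_map map_Suc_upt[symmetric] comp_def del: upt_Suc)
    then show ?thesis
      unfolding desc_def[of a] using assms that
      by (auto intro!: mprod_intertwine closed asc_shift simp del: upt_Suc)
  qed
  then have "asc a (Suc l) \<otimes> half_twist a l =
      mprod G (map (\<lambda>k. desc (Suc a) (Suc (Suc k))) [a..<l]) \<otimes> asc a (Suc l)"
    unfolding half_twist_def using assms by (intro mprod_intertwine) auto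
  moreover have "half_twist (Suc a) (Suc l) = mprod G (map (\<lambda>k. desc (Suc a) (Suc (Suc k))) [a..<l])"
    by (simp add: half_twist_def map_Suc_upt[symmetric] comp_def del: upt_Suc)
  ultimately show ?thesis using half_twist_Suc_asc[OF assms] by simp
qed

text \<open>A half twist splits off a shorter one on either side; one copy is split on the left and
  the other on the right, so that the shorter ones meet in the middle.\<close>

lemma half_twist_square:
  assumes "a < m" "m \<le> n"
  shows "half_twist a m \<otimes> half_twist a m = desc a m \<otimes> (half_twist (Suc a) m \<otimes> half_twist (Suc a) m) \<otimes> asc a m"
    and "half_twist a m \<otimes> half_twist a m = asc a m \<otimes> (half_twist a (m - 1) \<otimes> half_twist a (m - 1)) \<otimes> desc a m"
proof -
  obtain l where l: "m = Suc l" "a \<le> l" "l < n" using assms by (cases m) auto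
  show "half_twist a m \<otimes> half_twist a m = desc a m \<otimes> (half_twist (Suc a) m \<otimes> half_twist (Suc a) m) \<otimes> asc a m"
    using l half_twist_Suc_left[of a l] half_twist_Suc_left_asc[of a l] by (metis (no_types) Suc_leI asc_closed desc_closed half_twist_closed m_assoc m_closed)
  show "half_twist a m \<otimes> half_twist a m = asc a m \<otimes> (half_twist a (m - 1) \<otimes> half_twist a (m - 1)) \<otimes> desc a m"
    using l half_twist_Suc[of a l] half_twist_Suc_asc[of a l] 
    by (metis (no_types) Suc_leI asc_closed desc_closed diff_Suc_1 half_twist_closed less_imp_le_nat m_assoc m_closed)
qed

lemma desc_asc_one_iff:
  assumes "m \<le> n"
  shows "desc a m \<otimes> asc a m = \<one> \<longleftrightarrow> asc a m \<otimes> desc a m = \<one>"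
  using assms by (metis asc_closed desc_closed inv_char inv_comm)

lemma half_twist_iff_sphere:
  assumes "n > 1"
  shows "half_twist_relations G \<rho> n \<longleftrightarrow> sphere_relations G \<rho> n"
proof -
  let ?x = "asc 0 n" and ?y = "desc 0 n" and ?d = "half_twist 0 n \<otimes> half_twist 0 n"
    and ?e = "half_twist 0 (n - 1) \<otimes> half_twist 0 (n - 1)" and ?f = "half_twist 1 n \<otimes> half_twist 1 n"
  have c: "?x \<in> carrier G" "?y \<in> carrier G" "?d \<in> carrier G" "?e \<in> carrier G" "?f \<in> carrier G"
    by auto
  have f: "?d = ?y \<otimes> ?f \<otimes> ?x" and e: "?d = ?x \<otimes> ?e \<otimes> ?y"
    using half_twist_square[of 0 n] assms by auto
  have yx: "?y \<otimes> ?x = \<one> \<longleftrightarrow> ?x \<otimes> ?y = \<one>"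
    by (rule desc_asc_one_iff) simp
  have "?e = \<one>" if "?d = \<one>" "?x \<otimes> ?y = \<one>"
  proof -
    have "?y \<otimes> ?x = \<one>" using that yx by simp
    then have "?e = ?y \<otimes> (?x \<otimes> ?e \<otimes> ?y) \<otimes> ?x"
      using c by (metis l_one m_assoc m_closed r_one)
    then show ?thesis using that e c yx by simp
  qed
  then show ?thesis
    unfolding half_twist_relations_iff[OF assms] sphere_relations_iff[OF assms]
    using f yx c by (metis r_one)
qed

lemma desc_pow_shift:
  assumes "j + m \<le> n"
  shows "desc 0 n [^] m \<otimes> desc (a + m) (j + m) = desc a j \<otimes> desc 0 n [^] m"
  using assms
proof (induction m)
  case 0
  then show ?case by simp
next
  case (Suc m)
  have "desc 0 n [^] Suc m \<otimes> desc (a + Suc m) (j + Suc m) =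
      desc 0 n [^] m \<otimes> (desc 0 n \<otimes> desc (Suc (a + m)) (Suc (j + m)))"
    using Suc.prems by (simp add: m_assoc)
  also have "\<dots> = desc 0 n [^] m \<otimes> desc (a + m) (j + m) \<otimes> desc 0 n"
    using Suc.prems by (simp add: desc_desc_shift m_assoc)
  also have "\<dots> = desc a j \<otimes> desc 0 n [^] Suc m"
    using Suc by (simp add: m_assoc)
  finally show ?case .
qed

lemma half_twist_mult_ht:
  assumes "n > 0"
  shows "half_twist 1 n \<otimes> half_twist 0 n = desc 0 n [^] n"
proof -
  \<comment> \<open>Only the last m factors of \<open>half_twist 1 n\<close> are paired with the
    first m of \<open>half_twist 0 n\<close>; the product grows at both ends, and each new pair of
    outer factors contributes one Coxeter element.\<close>
  have "mprod G (map (\<lambda>k. desc 1 (Suc k)) [n - m..<n]) \<otimes> half_twist 0 m = desc 0 n [^] m" if "m \<le> n" for m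
    using that
  proof (induction m)
    case 0
    then show ?case by simp
  next
    case (Suc m)
    let ?z = "mprod G (map (\<lambda>k. desc 1 (Suc k)) [n - m..<n])"
    have c: "?z \<in> carrier G" by (auto intro!: mprod_closed)
    have "[n - Suc m..<n] = (n - Suc m) # [n - m..<n]"
      using Suc.prems by (metis Suc_diff_Suc Suc_le_lessD diff_less upt_conv_Cons zero_less_Suc less_le_trans)
    then have "mprod G (map (\<lambda>k. desc 1 (Suc k)) [n - Suc m..<n]) \<otimes> half_twist 0 (Suc m) =
        desc 1 (n - m) \<otimes> ?z \<otimes> (half_twist 0 m \<otimes> desc 0 (Suc m))"
      using Suc.prems by (simp add: half_twist_Suc Suc_diff_Suc del: upt_Suc)
    also have "\<dots> = desc 1 (n - m) \<otimes> (?z \<otimes> half_twist 0 m) \<otimes> desc 0 (Suc m)"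
      using Suc.prems c by (simp add: m_assoc)
    \<comment> \<open>Moved through the power, the new left factor becomes exactly the upper part
      that \<open>desc 0 (Suc m)\<close> lacks.\<close>
    also have "\<dots> = desc 0 n [^] m \<otimes> desc (1 + m) n \<otimes> desc 0 (Suc m)"
      using Suc desc_pow_shift[of "n - m" m 1] by simp
    also have "\<dots> = desc 0 n [^] Suc m"
      using Suc.prems desc_append[of 0 "Suc m" n] by (simp add: m_assoc)
    finally show ?case .
  qed
  from this[of n] have "mprod G (map (\<lambda>k. desc 1 (Suc k)) [0..<n]) \<otimes> half_twist 0 n = desc 0 n [^] n"
    by simp
  \<comment> \<open>The factor for k = 0 is the empty product \<open>desc 1 1\<close>.\<close>
  moreover have "mprod G (map (\<lambda>k. desc 1 (Suc k)) [0..<n]) = half_twist 1 n"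
    using assms half_twist_closed[of n 1] by (simp add: half_twist_def upt_conv_Cons[of 0])
  ultimately show ?thesis by simp
qed

lemma half_twist_square_eq_pow:
  assumes "n > 0"
  shows "half_twist 0 n \<otimes> half_twist 0 n = desc 0 n [^] Suc n"
proof -
  have "half_twist 0 n = desc 0 n \<otimes> half_twist 1 n"
    using half_twist_Suc_left[of 0 "n - 1"] assms by simp
  then have "half_twist 0 n \<otimes> half_twist 0 n = desc 0 n \<otimes> (half_twist 1 n \<otimes> half_twist 0 n)"
    by (metis desc_closed half_twist_closed m_assoc order_refl)
  then show ?thesis using assms by (metis desc_closed half_twist_mult_ht nat_pow_Suc2 order_refl)
qed

lemma sphere_relations_if_pow:
  assumes "n > 1" "desc 0 n [^] Suc n = \<one>" "desc 0 n \<otimes> asc 0 n = \<one>"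
  shows "sphere_relations G \<rho> n"
proof -
  let ?x = "asc 0 n" and ?y = "desc 0 n" and ?f = "half_twist 1 n \<otimes> half_twist 1 n"
  have c: "?x \<in> carrier G" "?y \<in> carrier G" "?f \<in> carrier G" by auto
  have xy: "?x \<otimes> ?y = \<one>" using assms desc_asc_one_iff[of n 0] by simp
  have "?y \<otimes> ?f \<otimes> ?x = \<one>"
    using half_twist_square(1)[of 0 n] half_twist_square_eq_pow assms by simp
  then have "?x \<otimes> (?y \<otimes> ?f \<otimes> ?x) \<otimes> ?y = \<one>" using c xy by simp
  moreover have "?x \<otimes> (?y \<otimes> ?f \<otimes> ?x) \<otimes> ?y = ?f"
    using c xy by (metis l_one m_assoc m_closed r_one)
  ultimately show ?thesis
    using assms by (simp add: sphere_relations_iff)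
qed

text \<open>With x = \<open>asc 1 n\<close> and y = \<open>desc 1 n\<close>, all three expressions
  solve y z x = 1 for z: the square of \<open>\<rho> 0\<close> by the sphere relation, that of
  \<open>half_twist 2 n\<close> because the square of \<open>half_twist 1 n\<close> is trivial, and
  the product of inverses directly.\<close>

lemma sphere_relations_square:
  assumes "n > 1" "sphere_relations G \<rho> n"
  shows "\<rho> 0 [^] (2::nat) =
      mprod G (map (\<lambda>i. inv (\<rho> i)) [1..<n-1]) \<otimes> (inv (\<rho> (n-1))) [^] (2::nat) \<otimes>
      mprod G (map (\<lambda>i. inv (\<rho> i)) (rev [1..<n-1]))" (is ?A)
    and "\<rho> 0 [^] (2::nat) = \<Delta> G \<rho> 2 (n-1) [^] (2::nat)" (is ?B)
proof -
  let ?x = "asc 1 n" and ?y = "desc 1 n" and ?f = "half_twist 2 n \<otimes> half_twist 2 n" and ?s = "\<rho> 0 [^] (2::nat)"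
  have c: "?x \<in> carrier G" "?y \<in> carrier G" "?f \<in> carrier G" "?s \<in> carrier G"
    using assms closed[of 0] by auto
  have solve: "z = inv ?y \<otimes> inv ?x" if "?y \<otimes> z \<otimes> ?x = \<one>" "z \<in> carrier G" for z
    using that c by (metis inv_closed inv_equality inv_solve_left' l_one m_closed r_one inv_inv)
  have s: "?s = inv ?y \<otimes> inv ?x"
    using assms(2) c by (intro solve) (simp_all add: sphere_relations_def asc_def desc_def)
  have "?y \<otimes> ?f \<otimes> ?x = \<one>"
    using half_twist_square(1)[of 1 n] assms by (simp add: sphere_relations_iff numeral_2_eq_2)
  then have "?f = inv ?y \<otimes> inv ?x" using c by (intro solve)
  then show ?B using s assms by (simp add: \<Delta>_eq_ht numeral_2_eq_2)
  have split: "?y = \<rho> (n - 1) \<otimes> desc 1 (n - 1)" "?x = asc 1 (n - 1) \<otimes> \<rho> (n - 1)"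
    using assms desc_Suc[of 1 "n - 1"] asc_Suc[of 1 "n - 1"] by simp_all
  have invs: "inv (desc 1 (n - 1)) = mprod G (map (\<lambda>i. inv (\<rho> i)) [1..<n-1])"
    "inv (asc 1 (n - 1)) = mprod G (map (\<lambda>i. inv (\<rho> i)) (rev [1..<n-1]))"
    unfolding desc_def asc_def by (subst inv_mprod; auto simp: rev_map comp_def intro!: closed)+
  have "inv ?y \<otimes> inv ?x = inv (desc 1 (n - 1)) \<otimes> (inv (\<rho> (n - 1)) \<otimes> inv (\<rho> (n - 1))) \<otimes> inv (asc 1 (n - 1))"
    unfolding split using assms closed[of "n - 1"] by (simp add: inv_mult_group m_assoc)
  then show ?A
    using s assms closed[of "n - 1"] by (simp add: invs[simplified] numeral_2_eq_2)
qed

end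

section \<open>Free algebras and intervals\<close>

lemma free_alg_ops [simp]:
  "p \<oplus>\<^bsub>free_alg X\<^esub> p' = p + p'" "p \<otimes>\<^bsub>free_alg X\<^esub> p' = p * p'"
  "\<one>\<^bsub>free_alg X\<^esub> = 1" "\<zero>\<^bsub>free_alg X\<^esub> = 0"
  by (simp_all add: free_alg_def)

lemma ring_free_alg: "ring (free_alg X)"
proof -
  have closed: "p + p' \<in> carrier (free_alg X)" "p * p' \<in> carrier (free_alg X)"
    "- p \<in> carrier (free_alg X)"
    if "p \<in> carrier (free_alg X)" "p' \<in> carrier (free_alg X)" for p p' :: "'a free"
    using that keys_add[of p p'] keys_mult[of p p']
    by (fastforce simp: free_alg_def plus_fword_def)+
  have units: "0 \<in> carrier (free_alg X)" "1 \<in> carrier (free_alg X)"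
    by (auto simp: free_alg_def zero_fword_def)
  show ?thesis
  proof (rule ringI)
    show "abelian_group (free_alg X)"
      by (rule abelian_groupI) (auto simp: units closed algebra_simps intro: bexI[OF _ closed(3)])
    show "Group.monoid (free_alg X)"
      by (rule monoidI) (auto simp: units closed algebra_simps)
  qed (auto simp: algebra_simps)
qed

interpretation free_alg: ring "free_alg X"
  rewrites "p \<oplus>\<^bsub>free_alg X\<^esub> p' = p + p'" and "p \<otimes>\<^bsub>free_alg X\<^esub> p' = p * p'"
    and "\<one>\<^bsub>free_alg X\<^esub> = 1" and "\<zero>\<^bsub>free_alg X\<^esub> = 0"
  for X
  by (simp_all add: ring_free_alg)

lemma free_alg_minus [simp]: "p \<in> carrier (free_alg X) \<Longrightarrow> \<ominus>\<^bsub>free_alg X\<^esub> p = - p"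
  by (rule free_alg.minus_equality) (auto simp: free_alg_def)

lemma free_alg_uminus_closed [simp]: "p \<in> carrier (free_alg X) \<Longrightarrow> - p \<in> carrier (free_alg X)"
  by (simp add: free_alg_def)

lemma free_alg_diff_closed [simp]:
  "p \<in> carrier (free_alg X) \<Longrightarrow> p' \<in> carrier (free_alg X) \<Longrightarrow> p - p' \<in> carrier (free_alg X)"
  using free_alg.a_closed[of p X "- p'"] by simp

lemma const_closed [simp]: "const c \<in> carrier (free_alg X)"
  by (auto simp: const_def free_alg_def zero_fword_def)

lemma poly_mapping_sum_single: "p = (\<Sum>w\<in>Poly_Mapping.keys p. Poly_Mapping.single w (Poly_Mapping.lookup p w))"
  by (rule poly_mapping_eqI) (simp add: lookup_sum lookup_single when_def in_keys_iff)

lemma const_central: "p * const c = const c * p"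
proof -
  have *: "Poly_Mapping.single w d * const c = const c * Poly_Mapping.single w d" for w d
    by (simp add: const_def mult_single mult.commute)
  have "(\<Sum>w\<in>K. Poly_Mapping.single w (Poly_Mapping.lookup p w)) * const c =
      const c * (\<Sum>w\<in>K. Poly_Mapping.single w (Poly_Mapping.lookup p w))" for K
    by (simp add: sum_distrib_left sum_distrib_right *)
  then show ?thesis using poly_mapping_sum_single[of p] by metis
qed

lemma free_alg_induct [consumes 1, case_names const letter add mult]:
  assumes "p \<in> carrier (free_alg X)"
    and const: "\<And>c. P (const c)" and letter: "\<And>x. x \<in> X \<Longrightarrow> P (letter x)"
    and add: "\<And>p p'. \<lbrakk>p \<in> carrier (free_alg X); p' \<in> carrier (free_alg X); P p; P p'\<rbrakk> \<Longrightarrow> P (p + p')"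
    and mult: "\<And>p p'. \<lbrakk>p \<in> carrier (free_alg X); p' \<in> carrier (free_alg X); P p; P p'\<rbrakk> \<Longrightarrow> P (p * p')"
  shows "P p"
proof -
  have single: "Poly_Mapping.single (FWord ws) c \<in> carrier (free_alg X) \<and> P (Poly_Mapping.single (FWord ws) c)"
    if "set ws \<subseteq> X" for ws c
    using that
  proof (induction ws)
    case Nil
    then show ?case using const const_closed[of c X] by (simp add: const_def zero_fword_def)
  next
    case (Cons x ws)
    have "Poly_Mapping.single (FWord (x # ws)) c = letter x * Poly_Mapping.single (FWord ws) c"
      by (simp add: letter_def mult_single plus_fword_def)
    moreover have "letter x \<in> carrier (free_alg X)"
      using Cons.prems by (auto simp: letter_def free_alg_def)
    ultimately show ?case using Cons letter[of x] mult by auto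
  qed
  have "(\<Sum>w\<in>K. Poly_Mapping.single w (Poly_Mapping.lookup p w)) \<in> carrier (free_alg X) \<and>
      P (\<Sum>w\<in>K. Poly_Mapping.single w (Poly_Mapping.lookup p w))" if "K \<subseteq> Poly_Mapping.keys p" "finite K" for K
    using that(2,1)
  proof (induction K)
    case empty
    then show ?case using const[of 0] const_closed[of 0 X] by (simp add: const_def)
  next
    case (insert w K)
    have "set (letters w) \<subseteq> X" using insert.prems assms(1) by (auto simp: free_alg_def)
    then show ?case using insert single[of "letters w"] add by (auto simp: fword.collapse)
  qed
  from this[of "Poly_Mapping.keys p"] show ?thesis
    using poly_mapping_sum_single[of p] by simp
qed

lemma const_mult: "const c * const d = const (c * d)"
  by (simp add: const_def mult_single)

lemma const_diff: "const c - const d = const (c - d)"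
  by (simp add: const_def single_diff)

lemma const_one: "const 1 = 1"
  by (simp add: const_def)

lemma gen_closed [simp]: "I = {} \<or> I \<in> X \<Longrightarrow> gen I \<in> carrier (free_alg X)"
  by (auto simp: gen_def letter_def free_alg_def zero_fword_def)

lemma qcomm_closed [simp]:
  "p \<in> carrier (free_alg X) \<Longrightarrow> p' \<in> carrier (free_alg X) \<Longrightarrow> qcomm p p' \<in> carrier (free_alg X)"
  by (simp add: qcomm_def)

definition bracket_scalar :: Cq where
  "bracket_scalar = qq / (qq - 1 / qq)"

definition skein_poly ::
    "'a free \<Rightarrow> 'a free \<Rightarrow> 'a free \<Rightarrow> 'a free \<Rightarrow> 'a free \<Rightarrow> 'a free \<Rightarrow> 'a free" where
  "skein_poly x y s t u v = - qcomm x y + s * t + u * v"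

lemma skein_poly_closed [simp]:
  "\<lbrakk>x \<in> carrier (free_alg X); y \<in> carrier (free_alg X); s \<in> carrier (free_alg X);
    t \<in> carrier (free_alg X); u \<in> carrier (free_alg X); v \<in> carrier (free_alg X)\<rbrakk> \<Longrightarrow>
    skein_poly x y s t u v \<in> carrier (free_alg X)"
  by (simp add: skein_poly_def)

lemma qq_nonzero: "qq - 1 / qq \<noteq> 0" "qq \<noteq> 0"
proof -
  show "qq \<noteq> 0"
    by (simp add: qq_def Zero_fract_def eq_fract)
  have "qq * qq \<noteq> 1"
    by (simp add: qq_def One_fract_def eq_fract one_pCons)
  then show "qq - 1 / qq \<noteq> 0"
    using \<open>qq \<noteq> 0\<close> by (simp add: field_simps)
qed

text \<open>The two coefficients of the q-commutator differ by 1, so a single central element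
  determines the bracket.\<close>

lemma qcomm_eq: "qcomm x (y :: 'a free) = const bracket_scalar * (x * y - y * x) + y * x"
proof -
  have "1 / (qq - 1 / qq) * (1 / qq) = bracket_scalar - 1"
    using qq_nonzero unfolding bracket_scalar_def by (simp add: field_simps)
  then have *: "const (1 / (qq - 1 / qq)) * const (1 / qq) = (const bracket_scalar - 1 :: 'a free)"
    by (simp only: const_mult flip: const_diff const_one)
  have "const (1 / (qq - 1 / qq)) * const qq = (const bracket_scalar :: 'a free)"
    by (simp add: const_mult bracket_scalar_def)
  then have "qcomm x y = const bracket_scalar * (x * y) - (const bracket_scalar - 1) * (y * x)"
    using * by (simp add: qcomm_def right_diff_distrib flip: mult.assoc)
  then show ?thesis by (simp add: algebra_simps)
qed


section \<open>Intervals, holes and monotonic sequences in terms of endpoints\<close>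

abbreviation arc :: "nat \<Rightarrow> nat \<Rightarrow> nat set" where
  "arc a b \<equiv> {Suc a..b}"

lemma arc_conn [simp]: "a < b \<Longrightarrow> b \<le> n \<Longrightarrow> arc a b \<in> conn n"
  by (auto simp: conn_def connected_set_def)

lemma conn_arcE:
  assumes "I \<in> conn n" obtains a b where "a < b" "b \<le> n" "I = arc a b"
proof -
  obtain j k where jk: "j \<le> k" "I = {j..k}" "{j..k} \<subseteq> {1..n}"
    using assms by (auto simp: conn_def connected_set_def)
  then have "1 \<le> j" "k \<le> n" by auto
  with jk show ?thesis by (intro that[of "j - 1" k]) auto
qed

lemma hole_arc:
  assumes "a < b" "b \<le> c" "c < d"
  shows "hole (arc a b) (arc c d) = arc b c" "hole (arc c d) (arc a b) = arc b c"
proof -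
  have "Suc a \<in> arc a b" "b \<in> arc a b" "Suc c \<in> arc c d" "d \<in> arc c d" using assms by auto
  moreover have "\<not> (x < y \<and> y < z)" if "z \<in> arc a b" "x \<in> arc c d" for x y z
    using that assms by auto
  moreover have "(\<forall>i\<in>arc a b. \<forall>j\<in>arc c d. i < x \<and> x < j) \<longleftrightarrow> x \<in> arc b c" for x
  proof
    assume "\<forall>i\<in>arc a b. \<forall>j\<in>arc c d. i < x \<and> x < j"
    then have "b < x" "x < Suc c" using calculation(2,3) by blast+
    then show "x \<in> arc b c" by simp
  qed auto
  ultimately show "hole (arc a b) (arc c d) = arc b c" "hole (arc c d) (arc a b) = arc b c"
    unfolding hole_def by blast+
qed

lemma arc_Un: "a \<le> b \<Longrightarrow> b \<le> c \<Longrightarrow> arc a b \<union> arc b c = arc a c"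
  by auto

lemma gen2_arc:
  assumes "a < b" "b < c" "c < d"
  shows "gen2 (arc a b) (arc c d) = skein_poly (gen (arc a c)) (gen (arc b d))
      (gen (arc a b)) (gen (arc c d)) (gen (arc b c)) (gen (arc a d))" (is ?A)
    and "gen2 (arc c d) (arc a b) = skein_poly (gen (arc b d)) (gen (arc a c))
      (gen (arc c d)) (gen (arc a b)) (gen (arc b c)) (gen (arc a d))" (is ?B)
proof -
  have ne: "arc a b \<noteq> {}" "arc b c \<noteq> {}" "arc c d \<noteq> {}"
    using assms by auto
  have un: "arc a b \<union> arc b c = arc a c" "arc b c \<union> arc c d = arc b d" "arc a c \<union> arc c d = arc a d"
    "arc c d \<union> arc b c = arc b d" "arc b c \<union> arc a b = arc a c" "arc b d \<union> arc a b = arc a d"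
    using assms by auto
  have hole: "hole (arc a b) (arc c d) = arc b c" "hole (arc c d) (arc a b) = arc b c"
    using assms hole_arc by simp_all
  show ?A ?B
    unfolding gen2_def hole Let_def un skein_poly_def using ne by simp_all
qed

lemma gen2_adjacent:
  assumes "a < b" "b < c"
  shows "gen2 (arc a b) (arc b c) = gen (arc a c)" "gen2 (arc b c) (arc a b) = gen (arc a c)"
proof -
  have "arc a b \<union> arc b c = arc a c" "arc b c \<union> arc a b = arc a c" using assms by auto
  then show "gen2 (arc a b) (arc b c) = gen (arc a c)" "gen2 (arc b c) (arc a b) = gen (arc a c)"
    using hole_arc[of a b b c] assms by (simp_all add: gen2_def)
qed

lemma gen2_empty [simp]: "gen2 I {} = gen I" "gen2 {} I = gen I"
  by (simp_all add: gen2_def)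

lemma adjacent_arcs:
  assumes "set_less (arc a b) (arc c d)" "adjacent (arc a b) (arc c d)" "a < b" "c < d"
  shows "c = b"
proof -
  have mem: "b \<in> arc a b" "Suc c \<in> arc c d" using assms(3,4) by simp_all
  then have le: "b \<le> c" using assms(1) unfolding set_less_def by fastforce
  obtain j k where jk: "arc a b \<union> arc c d = {j..k}"
    using assms(2) unfolding adjacent_def connected_set_def by blast
  have "b \<in> {j..k}" "Suc c \<in> {j..k}" using mem jk by blast+
  then have "Suc b \<in> {j..k}" using le by simp
  then have "Suc b \<in> arc a b \<union> arc c d" using jk by blast
  then show ?thesis using le by simp
qed

lemma adjacent_sym: "adjacent I J \<Longrightarrow> adjacent J I"
  by (simp add: adjacent_def Int_commute Un_commute)

lemma arc_inj: "a < b \<Longrightarrow> arc a b = arc c d \<longleftrightarrow> a = c \<and> b = d"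
  by (auto simp: Icc_eq_Icc)

lemma all_less_two: "(\<forall>i. i < Suc (Suc 0) \<longrightarrow> P i) \<longleftrightarrow> P 0 \<and> P (Suc 0)"
  by (auto simp: less_Suc_eq)

lemma all_less_three: "(\<forall>i. i < Suc (Suc (Suc 0)) \<longrightarrow> P i) \<longleftrightarrow> P 0 \<and> P (Suc 0) \<and> P (Suc (Suc 0))"
  by (auto simp: less_Suc_eq)

text \<open>Order and adjacency become a shared endpoint, so that monotonic sequences unfold to
  increasing lists of vertices.\<close>

definition consecutive :: "nat \<Rightarrow> nat set \<Rightarrow> nat set \<Rightarrow> bool" where
  "consecutive n I J \<longleftrightarrow> (\<exists>a b c. a < b \<and> b < c \<and> c \<le> n \<and> I = arc a b \<and> J = arc b c)"

lemma consecutive_iff: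
  "consecutive n I J \<longleftrightarrow> I \<in> conn n \<and> J \<in> conn n \<and> set_less I J \<and> adjacent I J"
proof
  assume "consecutive n I J"
  then obtain a b c where abc: "a < b" "b < c" "c \<le> n" "I = arc a b" "J = arc b c"
    by (auto simp: consecutive_def)
  then have "connected_set (I \<union> J)"
    by (auto simp: arc_Un connected_set_def intro: exI[of _ "Suc a"])
  then show "I \<in> conn n \<and> J \<in> conn n \<and> set_less I J \<and> adjacent I J"
    using abc by (auto simp: set_less_def adjacent_def)
next
  assume *: "I \<in> conn n \<and> J \<in> conn n \<and> set_less I J \<and> adjacent I J"
  then obtain a b where I: "a < b" "b \<le> n" "I = arc a b" by (auto elim: conn_arcE)
  from * obtain c d where J: "c < d" "d \<le> n" "J = arc c d" by (auto elim: conn_arcE)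
  have "c = b" using * I J by (intro adjacent_arcs) auto
  then show "consecutive n I J" using I J by (auto simp: consecutive_def)
qed

lemma mono_adj3_iff:
  "mono_adj n [I1, I2, I3] \<longleftrightarrow>
    consecutive n I1 I2 \<and> consecutive n I2 I3 \<or> consecutive n I2 I1 \<and> consecutive n I3 I2"
  by (simp add: mono_adj_def all_less_two consecutive_iff) (blast intro: adjacent_sym)

lemma mono_adj4_iff:
  "mono_adj n [I1, I2, I3, I4] \<longleftrightarrow>
    consecutive n I1 I2 \<and> consecutive n I2 I3 \<and> consecutive n I3 I4 \<or>
    consecutive n I2 I1 \<and> consecutive n I3 I2 \<and> consecutive n I4 I3"
  by (simp add: mono_adj_def all_less_three consecutive_iff) (blast intro: adjacent_sym)

lemma consecutive3E:
  assumes "consecutive n I J" "consecutive n J K"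
  obtains a b c d where "a < b" "b < c" "c < d" "d \<le> n" "I = arc a b" "J = arc b c" "K = arc c d"
  using assms unfolding consecutive_def by (metis arc_inj)

lemma consecutive4E:
  assumes "consecutive n I J" "consecutive n J K" "consecutive n K L"
  obtains a b c d e where "a < b" "b < c" "c < d" "d < e" "e \<le> n"
    "I = arc a b" "J = arc b c" "K = arc c d" "L = arc d e"
  using assms(3) consecutive3E[OF assms(1,2)] unfolding consecutive_def by (metis arc_inj)

section \<open>The ring structure of \<open>aw(n)\<close>\<close>

lemma gen2_closed:
  assumes "a < b" "b < c" "c < d" "d \<le> n"
  shows "gen2 (arc a b) (arc c d) \<in> carrier (free_alg (conn n))"
    "gen2 (arc c d) (arc a b) \<in> carrier (free_alg (conn n))"
  using assms by (simp_all add: gen2_arc)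

lemma rel_ii_eq:
  "rel_ii n = {gen (I1 \<union> I2) - skein_poly (gen (I2 \<union> I3)) (gen2 I1 I3) (gen I1) (gen I2) (gen I3) (gen (I1 \<union> I2 \<union> I3))
    | I1 I2 I3. mono_adj n [I1, I2, I3]}"
  by (simp add: rel_ii_def skein_poly_def)

lemma rel_iii_eq:
  "rel_iii n = {gen2 I1 I4 - skein_poly (gen2 I1 I3) (gen (I3 \<union> I4)) (gen I1) (gen I4) (gen I3) (gen2 I1 (I3 \<union> I4))
    | I1 I2 I3 I4. mono_adj n [I1, I2, I3, I4]}"
  by (simp add: rel_iii_def skein_poly_def)

lemma rel_iiI:
  "mono_adj n [I1, I2, I3] \<Longrightarrow>
    gen (I1 \<union> I2) - skein_poly (gen (I2 \<union> I3)) (gen2 I1 I3) (gen I1) (gen I2) (gen I3) (gen (I1 \<union> I2 \<union> I3)) \<in> rels n"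
  unfolding rel_ii_eq by blast

lemma rel_iiiI:
  "mono_adj n [I1, I2, I3, I4] \<Longrightarrow>
    gen2 I1 I4 - skein_poly (gen2 I1 I3) (gen (I3 \<union> I4)) (gen I1) (gen I4) (gen I3) (gen2 I1 (I3 \<union> I4)) \<in> rels n"
  unfolding rel_iii_eq by blast

lemma rels_closed: "rels n \<subseteq> carrier (free_alg (conn n))"
proof -
  have "rel_i n \<subseteq> carrier (free_alg (conn n))"
    by (auto simp: rel_i_def)
  moreover have "rel_ii n \<subseteq> carrier (free_alg (conn n))"
  proof -
    have "gen (I1 \<union> I2) - skein_poly (gen (I2 \<union> I3)) (gen2 I1 I3) (gen I1) (gen I2) (gen I3) (gen (I1 \<union> I2 \<union> I3))
        \<in> carrier (free_alg (conn n))" if "mono_adj n [I1, I2, I3]" for I1 I2 I3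
      using that unfolding mono_adj3_iff
    proof (elim disjE conjE)
      assume "consecutive n I1 I2" "consecutive n I2 I3"
      then show ?thesis by (rule consecutive3E) (simp add: arc_Un gen2_closed)
    next
      assume "consecutive n I2 I1" "consecutive n I3 I2"
      then obtain a b c d where "a < b" "b < c" "c < d" "d \<le> n" "I3 = arc a b" "I2 = arc b c" "I1 = arc c d"
        using consecutive3E by metis
      then show ?thesis by (simp add: arc_Un gen2_closed Un_commute[of "arc c d"] Un_commute[of "arc b c" "arc a b"]
         Un_commute[of "arc b d"])
    qed
    then show ?thesis unfolding rel_ii_eq by blast
  qed
  moreover have "rel_iii n \<subseteq> carrier (free_alg (conn n))"
  proof -
    have "gen2 I1 I4 - skein_poly (gen2 I1 I3) (gen (I3 \<union> I4)) (gen I1) (gen I4) (gen I3) (gen2 I1 (I3 \<union> I4))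
        \<in> carrier (free_alg (conn n))" if "mono_adj n [I1, I2, I3, I4]" for I1 I2 I3 I4
      using that unfolding mono_adj4_iff
    proof (elim disjE conjE)
      assume "consecutive n I1 I2" "consecutive n I2 I3" "consecutive n I3 I4"
      then show ?thesis by (rule consecutive4E) (simp add: arc_Un gen2_closed)
    next
      assume "consecutive n I2 I1" "consecutive n I3 I2" "consecutive n I4 I3"
      then obtain a b c d e where "a < b" "b < c" "c < d" "d < e" "e \<le> n"
          "I4 = arc a b" "I3 = arc b c" "I2 = arc c d" "I1 = arc d e"
        using consecutive4E by metis
      then show ?thesis by (simp add: arc_Un gen2_closed Un_commute[of "arc b c" "arc a b"])
    qed
    then show ?thesis unfolding rel_iii_eq by blast
  qed
  ultimately show ?thesis by blast
qed

lemma aw_ideal: "ideal (genideal (free_alg (conn n)) (rels n)) (free_alg (conn n))"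
  by (rule free_alg.genideal_ideal) (rule rels_closed)

lemma aw_fields:
  "carrier (aw n) = carrier (free_alg (conn n) Quot genideal (free_alg (conn n)) (rels n))"
  "x \<otimes>\<^bsub>aw n\<^esub> y = x \<otimes>\<^bsub>free_alg (conn n) Quot genideal (free_alg (conn n)) (rels n)\<^esub> y"
  "x \<oplus>\<^bsub>aw n\<^esub> y = x \<oplus>\<^bsub>free_alg (conn n) Quot genideal (free_alg (conn n)) (rels n)\<^esub> y"
  "\<one>\<^bsub>aw n\<^esub> = \<one>\<^bsub>free_alg (conn n) Quot genideal (free_alg (conn n)) (rels n)\<^esub>"
  "\<zero>\<^bsub>aw n\<^esub> = \<zero>\<^bsub>free_alg (conn n) Quot genideal (free_alg (conn n)) (rels n)\<^esub>"
  "c \<odot>\<^bsub>aw n\<^esub> x = aw_class n (const c) \<otimes>\<^bsub>aw n\<^esub> x"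
  by (simp_all add: aw_def presented_alg_def Let_def aw_class_def)

lemma ring_aw: "ring (aw n)"
proof -
  interpret Q: ring "free_alg (conn n) Quot genideal (free_alg (conn n)) (rels n)"
    by (rule ideal.quotient_is_ring[OF aw_ideal])
  show ?thesis
  proof (rule ringI)
    show "abelian_group (aw n)"
      by (rule abelian_groupI) (simp_all add: aw_fields Q.a_assoc Q.a_comm Q.a_lcomm, (blast intro: Q.l_neg Q.a_inv_closed)?)
    show "Group.monoid (aw n)"
      by (rule monoidI) (auto simp: aw_fields Q.m_assoc)
  qed (auto simp: aw_fields Q.l_distr Q.r_distr)
qed

interpretation aw: ring "aw n" for n
  by (rule ring_aw)

lemma aw_class_closed [simp]: "p \<in> carrier (free_alg (conn n)) \<Longrightarrow> aw_class n p \<in> carrier (aw n)"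
  unfolding aw_class_def aw_fields
  by (rule ring_hom_closed[OF ideal.rcos_ring_hom[OF aw_ideal]])

lemma aw_class_hom:
  assumes "p \<in> carrier (free_alg (conn n))" "p' \<in> carrier (free_alg (conn n))"
  shows "aw_class n (p + p') = aw_class n p \<oplus>\<^bsub>aw n\<^esub> aw_class n p'"
    and "aw_class n (p * p') = aw_class n p \<otimes>\<^bsub>aw n\<^esub> aw_class n p'"
  using ring_hom_add[OF ideal.rcos_ring_hom[OF aw_ideal] assms] ring_hom_mult[OF ideal.rcos_ring_hom[OF aw_ideal] assms]
  unfolding aw_class_def aw_fields by simp_all

lemma aw_class_one: "aw_class n 1 = \<one>\<^bsub>aw n\<^esub>"
  using ring_hom_one[OF ideal.rcos_ring_hom[OF aw_ideal], of n] unfolding aw_class_def aw_fields by simp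

lemma aw_class_zero: "aw_class n 0 = \<zero>\<^bsub>aw n\<^esub>"
proof -
  have "0 \<in> carrier (free_alg (conn n))" by simp
  then have "aw_class n 0 = aw_class n 0 \<oplus>\<^bsub>aw n\<^esub> aw_class n 0"
    using aw_class_hom(1)[of 0 n 0] by simp
  then show ?thesis
    by (metis \<open>0 \<in> carrier (free_alg (conn n))\<close> aw.add.l_cancel_one' aw_class_closed)
qed

lemma aw_class_uminus:
  assumes "p \<in> carrier (free_alg (conn n))"
  shows "aw_class n (- p) = \<ominus>\<^bsub>aw n\<^esub> aw_class n p"
  using assms aw_class_hom(1)[of "- p" n p]
  by (intro aw.minus_equality[symmetric]) (simp_all add: aw_class_zero)

lemma aw_class_diff:
  assumes "p \<in> carrier (free_alg (conn n))" "p' \<in> carrier (free_alg (conn n))"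
  shows "aw_class n (p - p') = aw_class n p \<ominus>\<^bsub>aw n\<^esub> aw_class n p'"
  using assms aw_class_hom(1)[of p n "- p'"] by (simp add: aw_class_uminus a_minus_def)

lemma aw_class_eqI:
  assumes "p - p' \<in> rels n" "p \<in> carrier (free_alg (conn n))" "p' \<in> carrier (free_alg (conn n))"
  shows "aw_class n p = aw_class n p'"
proof -
  have "p - p' \<in> genideal (free_alg (conn n)) (rels n)"
    using assms(1) free_alg.genideal_self[OF rels_closed] by blast
  then have "aw_class n (p - p') = \<zero>\<^bsub>aw n\<^esub>"
    unfolding aw_class_def aw_fields FactRing_def
    using abelian_subgroup.a_rcos_const[OF abelian_subgroupI3[OF ideal.axioms(1)[OF aw_ideal]
        free_alg.abelian_group_axioms]]
    by simp
  then show ?thesis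
    using assms aw_class_hom(1)[of "p - p'" n p'] by simp
qed

lemma carrier_awE:
  assumes "x \<in> carrier (aw n)" obtains p where "p \<in> carrier (free_alg (conn n))" "x = aw_class n p"
  using assms by (auto simp: aw_fields FactRing_def A_RCOSETS_def' a_r_coset_def' aw_class_def)

section \<open>The product of all the algebras \<open>aw(n)\<close>\<close>

text \<open>
  No type consists of the elements of a single \<open>aw(n)\<close>, as \<open>n\<close> is a variable.  The product over all \<open>n\<close>
  is a type of class \<open>ring\<close>, so that the previous results apply to it.
\<close>

typedef aw_product = "{f :: nat \<Rightarrow> nat set free set. \<forall>n. f n \<in> carrier (aw n)}"
  morphisms coord Abs_aw_product
  by (rule exI[of _ "\<lambda>n. \<zero>\<^bsub>aw n\<^esub>"]) simp

setup_lifting type_definition_aw_product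

instantiation aw_product :: "{ring, monoid_mult}"
begin

lift_definition zero_aw_product :: aw_product is "\<lambda>n. \<zero>\<^bsub>aw n\<^esub>" by simp
lift_definition one_aw_product :: aw_product is "\<lambda>n. \<one>\<^bsub>aw n\<^esub>" by simp
lift_definition plus_aw_product :: "aw_product \<Rightarrow> aw_product \<Rightarrow> aw_product"
  is "\<lambda>f g n. f n \<oplus>\<^bsub>aw n\<^esub> g n" by simp
lift_definition times_aw_product :: "aw_product \<Rightarrow> aw_product \<Rightarrow> aw_product"
  is "\<lambda>f g n. f n \<otimes>\<^bsub>aw n\<^esub> g n" by simp
lift_definition uminus_aw_product :: "aw_product \<Rightarrow> aw_product"
  is "\<lambda>f n. \<ominus>\<^bsub>aw n\<^esub> f n" by simp
lift_definition minus_aw_product :: "aw_product \<Rightarrow> aw_product \<Rightarrow> aw_product"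
  is "\<lambda>f g n. f n \<ominus>\<^bsub>aw n\<^esub> g n" by simp

instance
proof
  fix x y z :: aw_product
  show "x + y = y + x"
    by (transfer; simp add: fun_eq_iff aw.a_comm)
  show "x + y + z = x + (y + z)" "0 + x = x" "- x + x = 0" "x - y = x + - y"
    "x * y * z = x * (y * z)" "1 * x = x" "x * 1 = x"
    "(x + y) * z = x * z + y * z" "x * (y + z) = x * y + x * z"
    by (transfer; simp add: fun_eq_iff aw.a_assoc aw.l_neg a_minus_def aw.m_assoc aw.l_distr aw.r_distr)+
qed

end

lemma coord_closed [simp]: "coord x n \<in> carrier (aw n)"
  using coord[of x] by simp

lemmas coord_simps =
  zero_aw_product.rep_eq one_aw_product.rep_eq plus_aw_product.rep_eq times_aw_product.rep_eq
  uminus_aw_product.rep_eq minus_aw_product.rep_eq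

lemma aw_product_eqI: "(\<And>m. coord x m = coord y m) \<Longrightarrow> x = y"
  by (metis coord_inject ext)

text \<open>
  The coordinates outside \<open>n\<close> are irrelevant, but the relations have to hold in them as well; they do
  when every generator has the value \<open>1\<close>.
\<close>

definition at_index :: "nat \<Rightarrow> nat set free \<Rightarrow> aw_product" where
  "at_index n p = Abs_aw_product (\<lambda>m. if m = n \<and> p \<in> carrier (free_alg (conn n)) then aw_class n p else \<one>\<^bsub>aw m\<^esub>)"

text \<open>The default 1 for p outside the free algebra keeps the function in the representing set,
  so the equation holds for every p.\<close>

lemma coord_pt:
  "coord (at_index n p) m = (if m = n \<and> p \<in> carrier (free_alg (conn n)) then aw_class n p else \<one>\<^bsub>aw m\<^esub>)"
  by (subst at_index_def, subst Abs_aw_product_inverse) auto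

lemma at_index_one [simp]: "at_index n 1 = 1"
  by (rule aw_product_eqI) (auto simp: coord_pt coord_simps aw_class_one)

lemma at_index_eq_iff:
  "\<lbrakk>p \<in> carrier (free_alg (conn n)); p' \<in> carrier (free_alg (conn n))\<rbrakk> \<Longrightarrow>
    at_index n p = at_index n p' \<longleftrightarrow> aw_class n p = aw_class n p'"
  by (metis aw_product_eqI coord_pt)

lemma at_index_eqI: "p - p' \<in> rels n \<Longrightarrow> p \<in> carrier (free_alg (conn n)) \<Longrightarrow>
    p' \<in> carrier (free_alg (conn n)) \<Longrightarrow> at_index n p = at_index n p'"
  by (simp add: at_index_eq_iff aw_class_eqI del: Un_iff)

definition scalar :: "nat \<Rightarrow> aw_product" where
  "scalar n = at_index n (const bracket_scalar)"

lemma scalar_central: "x * scalar n = scalar n * x"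
proof (rule aw_product_eqI)
  fix m
  obtain p where "p \<in> carrier (free_alg (conn m))" "coord x m = aw_class m p"
    using carrier_awE[OF coord_closed] by blast
  then show "coord (x * scalar n) m = coord (scalar n * x) m"
    by (auto simp: coord_simps scalar_def coord_pt const_central simp flip: aw_class_hom)
qed

interpretation aw_bracket: qbracket "scalar n" for n
  by unfold_locales (rule scalar_central)

lemma at_index_resolvent:
  assumes "p \<in> carrier (free_alg (conn n))" "p' \<in> carrier (free_alg (conn n))"
    "s \<in> carrier (free_alg (conn n))" "t \<in> carrier (free_alg (conn n))"
    "u \<in> carrier (free_alg (conn n))" "v \<in> carrier (free_alg (conn n))"
  shows "at_index n (skein_poly p p' s t u v) =
    aw_bracket.skein n (at_index n p) (at_index n p') (at_index n s) (at_index n t) (at_index n u) (at_index n v)"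
proof (rule aw_product_eqI)
  fix m
  show "coord (at_index n (skein_poly p p' s t u v)) m =
    coord (aw_bracket.skein n (at_index n p) (at_index n p') (at_index n s) (at_index n t) (at_index n u) (at_index n v)) m"
  proof (cases "m = n")
    case True
    then show ?thesis using assms
      unfolding aw_bracket.skein_def aw_bracket.qbr_def skein_poly_def qcomm_eq
      unfolding scalar_def
      by (simp add: coord_simps coord_pt aw_class_hom aw_class_uminus aw_class_diff)
  next
    case False
    \<comment> \<open>The bracket of 1 with 1 is 1 whatever the scalar, so the value is -1 + 1 +
      1.\<close>
    have "aw_bracket.skein n 1 1 1 1 1 1 = 1"
      by (simp add: aw_bracket.skein_def aw_bracket.qbr_def)
    then have "coord (at_index n (skein_poly p p' s t u v)) m = coord (aw_bracket.skein n 1 1 1 1 1 1) m"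
      using False by (simp add: coord_pt coord_simps)
    also have "\<dots> = coord (aw_bracket.skein n (at_index n p) (at_index n p') (at_index n s) (at_index n t) (at_index n u) (at_index n v)) m"
      unfolding aw_bracket.skein_def aw_bracket.qbr_def coord_simps coord_pt using False by simp
    finally show ?thesis .
  qed
qed

lemma at_index_gen_commute:
  assumes "I = {} \<or> I \<in> conn n" "J = {} \<or> J \<in> conn n" "I \<inter> J = {} \<or> I \<subseteq> J \<or> J \<subseteq> I"
  shows "at_index n (gen I) * at_index n (gen J) = at_index n (gen J) * at_index n (gen I)"
proof (rule aw_product_eqI)
  fix m
  have rel: "aw_class n (gen I * gen J) = aw_class n (gen J * gen I)"
    if "I \<in> conn n" "J \<in> conn n" "I \<inter> J = {} \<or> I \<subseteq> J" for I J
    using that by (intro aw_class_eqI) (auto simp: rel_i_def)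
  have "aw_class n (gen I * gen J) = aw_class n (gen J * gen I)"
    using assms rel[of I J] rel[of J I] by (cases "I = {} \<or> J = {}") (auto simp: gen_def)
  then show "coord (at_index n (gen I) * at_index n (gen J)) m = coord (at_index n (gen J) * at_index n (gen I)) m"
    using assms by (auto simp: coord_simps coord_pt simp flip: aw_class_hom)
qed

definition extend_auto :: "nat \<Rightarrow> (nat set free set \<Rightarrow> nat set free set) \<Rightarrow> aw_product \<Rightarrow> aw_product" where
  "extend_auto n f x = Abs_aw_product (\<lambda>m. if m = n then f (coord x m) else coord x m)"

lemma coord_extend:
  assumes "f \<in> ring_hom (aw n) (aw n)"
  shows "coord (extend_auto n f x) m = (if m = n then f (coord x m) else coord x m)"
  unfolding extend_auto_def
  by (subst Abs_aw_product_inverse) (auto simp: ring_hom_closed[OF assms])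

lemma extend_auto_hom:
  assumes f: "f \<in> ring_hom (aw n) (aw n)"
  shows "extend_auto n f (x + y) = extend_auto n f x + extend_auto n f y"
    and "extend_auto n f (x * y) = extend_auto n f x * extend_auto n f y"
    and "extend_auto n f 1 = 1"
  by (rule aw_product_eqI; simp add: coord_extend[OF f] coord_simps ring_hom_add[OF f]
      ring_hom_mult[OF f] ring_hom_one[OF f])+

lemma extend_auto_pt:
  assumes "f \<in> ring_hom (aw n) (aw n)" "p \<in> carrier (free_alg (conn n))" "p' \<in> carrier (free_alg (conn n))"
    "f (aw_class n p) = aw_class n p'"
  shows "extend_auto n f (at_index n p) = at_index n p'"
  using assms by (intro aw_product_eqI) (simp add: coord_extend coord_pt)

lemma alg_auto_const:
  assumes "f \<in> alg_auto (aw n)"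
  shows "f (aw_class n (const c)) = aw_class n (const c)"
proof -
  have hom: "f \<in> ring_hom (aw n) (aw n)" using assms by (simp add: alg_auto_def)
  have "f (c \<odot>\<^bsub>aw n\<^esub> \<one>\<^bsub>aw n\<^esub>) = c \<odot>\<^bsub>aw n\<^esub> f \<one>\<^bsub>aw n\<^esub>"
    using assms by (simp add: alg_auto_def)
  then show ?thesis
    using ring_hom_one[OF hom] by (simp add: aw_fields(6))
qed

lemma extend_auto_scalar: "f \<in> alg_auto (aw n) \<Longrightarrow> extend_auto n f (scalar n) = scalar n"
  unfolding scalar_def by (intro extend_auto_pt alg_auto_const) (auto simp: alg_auto_def)

section \<open>The chord relations in \<open>aw(n)\<close>\<close>

text \<open>Equal residues give the empty interval and hence 1; the closing side of the polygon,
  from n to n + 1, gives C_{1..n}.\<close>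

definition chord :: "nat \<Rightarrow> nat \<Rightarrow> nat \<Rightarrow> aw_product" where
  "chord n i j = at_index n (gen (arc (min (i mod Suc n) (j mod Suc n)) (max (i mod Suc n) (j mod Suc n))))"

lemma chord_linear: "a \<le> b \<Longrightarrow> b \<le> n \<Longrightarrow> chord n a b = at_index n (gen (arc a b))"
  by (simp add: chord_def)

lemma arc_cases: "a \<le> b \<Longrightarrow> b \<le> n \<Longrightarrow> arc a b = {} \<or> arc a b \<in> conn n"
  by (cases "a = b") auto

interpretation aw_chords: chords "scalar n" "Suc n" "chord n" for n
proof unfold_locales
  show "0 < Suc n" by simp
  show "chord n a b = chord n b a" for a b
    by (simp add: chord_def min.commute max.commute)
  show "chord n a a = 1" for a
    by (simp add: chord_def gen_def)
  show "chord n (a mod Suc n) b = chord n a b" for a b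
    by (simp add: chord_def)
  fix a b c d assume ord: "a \<le> b" "b \<le> c" "c \<le> d" "d < Suc n"
  have "at_index n (gen (arc a b)) * at_index n (gen (arc c d)) = at_index n (gen (arc c d)) * at_index n (gen (arc a b))"
    using ord by (intro at_index_gen_commute arc_cases) auto
  moreover have "at_index n (gen (arc b c)) * at_index n (gen (arc a d)) = at_index n (gen (arc a d)) * at_index n (gen (arc b c))"
    using ord by (intro at_index_gen_commute arc_cases) auto
  ultimately show "chord n a b * chord n c d = chord n c d * chord n a b \<and>
      chord n b c * chord n a d = chord n a d * chord n b c"
    using ord by (simp add: chord_linear)
qed

lemma at_index_gen2:
  assumes "a < b" "b < c" "c < d" "d \<le> n"
  shows "at_index n (gen2 (arc a b) (arc c d)) = aw_bracket.skein n (chord n a c) (chord n b d)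
      (chord n a b) (chord n c d) (chord n b c) (chord n a d)"
    and "at_index n (gen2 (arc c d) (arc a b)) = aw_bracket.skein n (chord n b d) (chord n a c)
      (chord n c d) (chord n a b) (chord n b c) (chord n a d)"
  using assms by (simp_all add: gen2_arc at_index_resolvent chord_linear)

lemma consecutive_arcs: "a < b \<Longrightarrow> b < c \<Longrightarrow> c \<le> n \<Longrightarrow> consecutive n (arc a b) (arc b c)"
  by (auto simp: consecutive_def)

lemma at_index_rel_ii:
  assumes "a < b" "b < c" "c < d" "d \<le> n"
  shows "chord n a c = aw_bracket.skein n (chord n b d) (at_index n (gen2 (arc a b) (arc c d)))
      (chord n a b) (chord n b c) (chord n c d) (chord n a d)"
    and "chord n b d = aw_bracket.skein n (chord n a c) (at_index n (gen2 (arc c d) (arc a b)))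
      (chord n c d) (chord n b c) (chord n a b) (chord n a d)"
proof -
  have un: "arc a b \<union> arc b c = arc a c" "arc b c \<union> arc c d = arc b d" "arc a c \<union> arc c d = arc a d"
    "arc c d \<union> arc b c = arc b d" "arc b c \<union> arc a b = arc a c" "arc b d \<union> arc a b = arc a d"
    using assms by auto
  have "mono_adj n [arc a b, arc b c, arc c d]" "mono_adj n [arc c d, arc b c, arc a b]"
    using assms by (simp_all add: mono_adj3_iff consecutive_arcs)
  note this[THEN rel_iiI, unfolded un]
  from this[THEN at_index_eqI] show "chord n a c = aw_bracket.skein n (chord n b d) (at_index n (gen2 (arc a b) (arc c d)))
      (chord n a b) (chord n b c) (chord n c d) (chord n a d)"
    "chord n b d = aw_bracket.skein n (chord n a c) (at_index n (gen2 (arc c d) (arc a b)))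
      (chord n c d) (chord n b c) (chord n a b) (chord n a d)"
    using assms by (simp_all add: gen2_closed at_index_resolvent chord_linear)
qed

lemma at_index_rel_iii:
  assumes "a < b" "b < c" "c < d" "d < e" "e \<le> n"
  shows "at_index n (gen2 (arc a b) (arc d e)) =
      aw_bracket.skein n (at_index n (gen2 (arc a b) (arc c d))) (chord n c e) (chord n a b) (chord n d e)
        (chord n c d) (at_index n (gen2 (arc a b) (arc c e)))"
    and "at_index n (gen2 (arc d e) (arc a b)) =
      aw_bracket.skein n (at_index n (gen2 (arc d e) (arc b c))) (chord n a c) (chord n d e) (chord n a b)
        (chord n b c) (at_index n (gen2 (arc d e) (arc a c)))"
proof -
  have un: "arc c d \<union> arc d e = arc c e" "arc b c \<union> arc a b = arc a c"
    using assms by auto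
  have "mono_adj n [arc a b, arc b c, arc c d, arc d e]" "mono_adj n [arc d e, arc c d, arc b c, arc a b]"
    using assms by (simp_all add: mono_adj4_iff consecutive_arcs)
  note this[THEN rel_iiiI, unfolded un]
  from this[THEN at_index_eqI] show "at_index n (gen2 (arc a b) (arc d e)) =
      aw_bracket.skein n (at_index n (gen2 (arc a b) (arc c d))) (chord n c e) (chord n a b) (chord n d e)
        (chord n c d) (at_index n (gen2 (arc a b) (arc c e)))"
    "at_index n (gen2 (arc d e) (arc a b)) =
      aw_bracket.skein n (at_index n (gen2 (arc d e) (arc b c))) (chord n a c) (chord n d e) (chord n a b)
        (chord n b c) (at_index n (gen2 (arc d e) (arc a c)))"
    using assms by (simp_all add: gen2_closed at_index_resolvent chord_linear)
qed

interpretation aw_chords: chord_relations "scalar n" "Suc n" "chord n" for n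
proof unfold_locales
  fix a b c d assume ord: "a < b" "b < c" "c < d" "d < Suc n"
  have sym: "chord n c a = chord n a c" "chord n d a = chord n a d" "chord n b a = chord n a b"
    by (rule aw_chords.E_sym)+
  have comm: "chord n c d * chord n a b = chord n a b * chord n c d"
    "chord n b c * chord n a d = chord n a d * chord n b c"
    "chord n c d * chord n b c = chord n b c * chord n c d"
    "chord n a d * chord n a b = chord n a b * chord n a d"
    using aw_chords.E_commute[of a b c d n] aw_chords.E_commute[of b c c d n] aw_chords.E_commute[of a a b d n] ord
    by simp_all
  have "aw_chords.skein_chord n a b c d = at_index n (gen2 (arc a b) (arc c d))"
    using ord by (simp add: aw_chords.skein_chord_def at_index_gen2)
  \<comment> \<open>Starting the quadrilateral one vertex later reverses the order of the two index
    sets.\<close>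
  moreover have "aw_chords.skein_chord n b c d a = at_index n (gen2 (arc c d) (arc a b))"
    using ord by (simp add: aw_chords.skein_chord_def at_index_gen2 sym aw_bracket.skein_def comm)
  moreover have "aw_bracket.skein n x y (chord n c d) (chord n b c) (chord n a b) (chord n a d) =
      aw_bracket.skein n x y (chord n b c) (chord n c d) (chord n a d) (chord n a b)" for x y
    by (simp add: aw_bracket.skein_def comm)
  ultimately show "chord n a c = aw_bracket.skein n (chord n b d) (aw_chords.skein_chord n a b c d)
        (chord n a b) (chord n b c) (chord n c d) (chord n a d) \<and>
      chord n b d = aw_bracket.skein n (chord n a c) (aw_chords.skein_chord n b c d a)
        (chord n b c) (chord n c d) (chord n a d) (chord n a b)"
    using at_index_rel_ii[of a b c d n] ord by (metis less_Suc_eq_le)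
next
  fix a b c d e assume ord: "a < b" "b < c" "c < d" "d < e" "e < Suc n"
  \<comment> \<open>Descending sequences in relation (iii) give this orientation, ascending ones the
    reversed one.\<close>
  have "aw_chords.pent n a b c d e"
    using ord at_index_rel_iii(2)[of a b c d e n] by (intro aw_chords.pentI) (simp_all add: at_index_gen2)
  moreover have "aw_chords.pent n e d c b a"
    using ord at_index_rel_iii(1)[of a b c d e n] by (intro aw_chords.pent_revI) (simp_all add: at_index_gen2)
  ultimately show "aw_chords.pent n a b c d e \<and> aw_chords.pent n e d c b a" by simp
qed

section \<open>The maps \<open>r\<^sub>a\<close> as twists\<close>

lemma alg_autoD:
  assumes "f \<in> alg_auto (aw n)"
  shows "f \<in> ring_hom (aw n) (aw n)" "f \<in> Bij (carrier (aw n))"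
    "x \<in> carrier (aw n) \<Longrightarrow> f (c \<odot>\<^bsub>aw n\<^esub> x) = c \<odot>\<^bsub>aw n\<^esub> f x"
  using assms by (auto simp: alg_auto_def)

lemma subgroup_alg_auto: "subgroup (alg_auto (aw n)) (BijGroup (carrier (aw n)))"
proof (rule subgroup.intro)
  let ?S = "carrier (aw n)"
  have smult: "c \<odot>\<^bsub>aw n\<^esub> x \<in> ?S" if "x \<in> ?S" for c x
    using that by (simp add: aw_fields(6))
  show "alg_auto (aw n) \<subseteq> carrier (BijGroup ?S)"
    by (auto simp: alg_auto_def BijGroup_def)
  show "\<one>\<^bsub>BijGroup ?S\<^esub> \<in> alg_auto (aw n)"
    using smult by (auto simp: alg_auto_def BijGroup_def id_Bij intro!: ring_hom_memI)
  fix f assume f: "f \<in> alg_auto (aw n)"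
  note hom = alg_autoD(1)[OF f] and bij = alg_autoD(2)[OF f]
  {
    fix g assume g: "g \<in> alg_auto (aw n)"
    have closed: "g x \<in> ?S" if "x \<in> ?S" for x
      using ring_hom_closed[OF alg_autoD(1)[OF g]] that .
    have "compose ?S f g \<in> ring_hom (aw n) (aw n)"
      by (rule ring_hom_memI)
        (simp_all add: compose_eq closed ring_hom_closed[OF hom]
          ring_hom_mult[OF hom] ring_hom_add[OF hom] ring_hom_one[OF hom]
          ring_hom_mult[OF alg_autoD(1)[OF g]] ring_hom_add[OF alg_autoD(1)[OF g]] ring_hom_one[OF alg_autoD(1)[OF g]])
    moreover have "compose ?S f g (c \<odot>\<^bsub>aw n\<^esub> x) = c \<odot>\<^bsub>aw n\<^esub> compose ?S f g x" if "x \<in> ?S" for c x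
      using that smult closed by (simp add: compose_eq alg_autoD(3)[OF f] alg_autoD(3)[OF g])
    ultimately show "f \<otimes>\<^bsub>BijGroup ?S\<^esub> g \<in> alg_auto (aw n)"
      using bij alg_autoD(2)[OF g] by (simp add: alg_auto_def BijGroup_def compose_Bij)
  }
  let ?g = "\<lambda>x\<in>?S. inv_into ?S f x"
  have img: "f ` ?S = ?S" using bij by (simp add: Bij_def bij_betw_def)
  have closed: "inv_into ?S f x \<in> ?S" if "x \<in> ?S" for x
    using bij that by (rule Bij_inv_into_mem)
  have inv: "inv_into ?S f (f x) = x" if "x \<in> ?S" for x
    using bij that by (simp add: Bij_def bij_betw_def)
  have f_inv: "f (inv_into ?S f x) = x" if "x \<in> ?S" for x
    using that img by (simp add: f_inv_into_f)
  have "?g \<in> ring_hom (aw n) (aw n)"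
  proof (rule ring_hom_memI)
    show "?g \<one>\<^bsub>aw n\<^esub> = \<one>\<^bsub>aw n\<^esub>"
      using inv[of "\<one>\<^bsub>aw n\<^esub>"] ring_hom_one[OF hom] by simp
    fix x y assume xy: "x \<in> ?S" "y \<in> ?S"
    show "?g x \<in> ?S" using xy closed by simp
    show "?g (x \<otimes>\<^bsub>aw n\<^esub> y) = ?g x \<otimes>\<^bsub>aw n\<^esub> ?g y"
      using inv[of "inv_into ?S f x \<otimes>\<^bsub>aw n\<^esub> inv_into ?S f y"] xy closed
      by (simp add: ring_hom_mult[OF hom] f_inv)
    show "?g (x \<oplus>\<^bsub>aw n\<^esub> y) = ?g x \<oplus>\<^bsub>aw n\<^esub> ?g y"
      using inv[of "inv_into ?S f x \<oplus>\<^bsub>aw n\<^esub> inv_into ?S f y"] xy closed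
      by (simp add: ring_hom_add[OF hom] f_inv)
  qed
  moreover have "?g (c \<odot>\<^bsub>aw n\<^esub> x) = c \<odot>\<^bsub>aw n\<^esub> ?g x" if "x \<in> ?S" for c x
    using inv[of "c \<odot>\<^bsub>aw n\<^esub> inv_into ?S f x"] that closed smult
    by (simp add: alg_autoD(3)[OF f] f_inv)
  ultimately show "inv\<^bsub>BijGroup ?S\<^esub> f \<in> alg_auto (aw n)"
    using bij unfolding inv_BijGroup[OF bij] alg_auto_def by (simp add: restrict_inv_into_Bij del: restrict_apply)
qed

lemma group_AlgAut: "group (AlgAut (aw n))"
  unfolding AlgAut_def by (rule subgroup.subgroup_is_group[OF subgroup_alg_auto group_BijGroup])

lemma carrier_AlgAut [simp]: "carrier (AlgAut A) = alg_auto A"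
  by (simp add: AlgAut_def)

lemma extend_auto_mult:
  assumes "f \<in> alg_auto (aw n)" "g \<in> alg_auto (aw n)"
  shows "extend_auto n (f \<otimes>\<^bsub>AlgAut (aw n)\<^esub> g) x = extend_auto n f (extend_auto n g x)"
proof -
  have fg: "f \<otimes>\<^bsub>AlgAut (aw n)\<^esub> g = compose (carrier (aw n)) f g"
    using assms by (simp add: AlgAut_def BijGroup_def alg_auto_def)
  have "f \<otimes>\<^bsub>AlgAut (aw n)\<^esub> g \<in> alg_auto (aw n)"
    using monoid.m_closed[OF group.is_monoid[OF group_AlgAut]] assms by simp
  then show ?thesis
    using assms by (intro aw_product_eqI)
      (simp add: coord_extend alg_autoD(1), simp add: fg compose_eq)
qed

lemma extend_auto_one: "extend_auto n \<one>\<^bsub>AlgAut (aw n)\<^esub> x = x"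
proof -
  have "\<one>\<^bsub>AlgAut (aw n)\<^esub> \<in> alg_auto (aw n)"
    using monoid.one_closed[OF group.is_monoid[OF group_AlgAut]] by simp
  then show ?thesis
    by (intro aw_product_eqI) (simp add: coord_extend alg_autoD(1), simp add: AlgAut_def BijGroup_def)
qed

text \<open>Compatibility with scalars settles the constants and the chords settle the letters;
  induction over the free algebra does the rest. Outside the carrier the maps agree by
  extensionality.\<close>

lemma alg_auto_eqI:
  assumes f: "f \<in> alg_auto (aw n)" and g: "g \<in> alg_auto (aw n)"
    and eq: "\<And>a b. extend_auto n f (chord n a b) = extend_auto n g (chord n a b)"
  shows "f = g"
proof -
  note fh = alg_autoD(1)[OF f] and gh = alg_autoD(1)[OF g]
  have "f (aw_class n p) = g (aw_class n p)" if "p \<in> carrier (free_alg (conn n))" for p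
    using that
  proof (induction rule: free_alg_induct)
    case (const c)
    then show ?case using alg_auto_const[OF f] alg_auto_const[OF g] by simp
  next
    case (letter I)
    then obtain a b where ab: "a < b" "b \<le> n" "I = arc a b" by (rule conn_arcE)
    have "gen I = letter I" "gen I \<in> carrier (free_alg (conn n))"
      using letter ab gen_closed[of I "conn n"] by (auto simp: gen_def)
    moreover have "coord (extend_auto n f (chord n a b)) n = coord (extend_auto n g (chord n a b)) n"
      using eq by simp
    ultimately show ?case using ab
      by (simp add: coord_extend fh gh chord_linear coord_pt)
  next
    case (add p p')
    then show ?case by (simp add: aw_class_hom ring_hom_add[OF fh] ring_hom_add[OF gh])
  next
    case (mult p p')
    then show ?case by (simp add: aw_class_hom ring_hom_mult[OF fh] ring_hom_mult[OF gh])
  qed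
  moreover have "f \<in> extensional (carrier (aw n))" "g \<in> extensional (carrier (aw n))"
    using alg_autoD(2)[OF f] alg_autoD(2)[OF g] by (simp_all add: Bij_def)
  ultimately show ?thesis
    by (metis carrier_awE extensionalityI)
qed

lemma gen_arc_closed: "a \<le> b \<Longrightarrow> b \<le> n \<Longrightarrow> gen (arc a b) \<in> carrier (free_alg (conn n))"
  by (rule gen_closed) (rule arc_cases)

lemma is_r_fix_linear:
  assumes r: "is_r n i f" and ord: "a < b" "b \<le> n" "a \<noteq> i" "b \<noteq> i"
  shows "extend_auto n f (chord n a b) = chord n a b"
proof -
  have f: "f \<in> alg_auto (aw n)" using r by (simp add: is_r_def)
  have "f (C n {Suc a..b}) = C n {Suc a..b}"
  proof (cases "i = 0")
    case True
    then have "2 \<le> Suc a" "Suc a \<le> b" using ord by auto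
    then show ?thesis using r ord True unfolding is_r_def by auto
  next
    case False
    \<comment> \<open>An interval separates i from i + 1 only if i is one of the two bounding gaps a
      and b.\<close>
    have "{i, i + 1} \<subseteq> {Suc a..b} \<or> {i, i + 1} \<inter> {Suc a..b} = {}"
      using ord by (cases "a < i \<and> i < b") auto
    then show ?thesis using r ord False unfolding is_r_def by auto
  qed
  then show ?thesis
    using ord f by (simp add: C_def chord_linear extend_auto_pt alg_autoD(1))
qed

lemma extend_auto_C2:
  assumes "f \<in> alg_auto (aw n)" "a < b" "b \<le> n" "f (C n (arc a b)) = C2 n I J"
    "gen2 I J \<in> carrier (free_alg (conn n))"
  shows "extend_auto n f (chord n a b) = at_index n (gen2 I J)"
  using assms by (simp add: C_def C2_def chord_linear extend_auto_pt alg_autoD(1))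

text \<open>Modulo n + 1, i + n is i - 1. In this form \<open>r 0\<close>, with neighbouring
  vertices n and 1, obeys the same rule as the others; merged and dropped index sets turn into
  degenerate crossings.\<close>

lemma is_r_move_linear:
  assumes r: "is_r n i f" and i: "i < n" "c \<le> n" "c \<noteq> i"
  shows "extend_auto n f (chord n i c) = aw_chords.skein_chord n (i + n) i (i + 1) c"
proof -
  have f: "f \<in> alg_auto (aw n)" using r by (simp add: is_r_def)
  have swap: "aw_bracket.skein n x y p1 p2 p3 p4 = aw_bracket.skein n x y p3 p4 p1 p2" for x y p1 p2 p3 p4
    by (simp add: aw_bracket.skein_def)
  note sym = aw_chords.E_sym[of n]
  consider "i = 0" | "0 < i" "i < c" | "0 < i" "c < i" using i by linarith
  then show ?thesis
  proof cases
    case 1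
    then have c: "0 < c" using i by simp
    have shift: "aw_chords.skein_chord n (i + n) i (i + 1) c = aw_chords.skein_chord n n 0 1 c"
      using 1 by simp
    have m: "Suc (Suc n) mod Suc n = 1 mod Suc n"
      using mod_add_self2[of 1 "Suc n"] by simp
    have val: "f (C n (arc 0 c)) = C2 n (arc c n) (arc 0 1)"
      using r 1 c i unfolding is_r_def by (auto simp: numeral_2_eq_2)
    consider "c = n" | "c = 1" "c < n" | "1 < c" "c < n" using i c by linarith
    then show ?thesis
    proof cases
      assume cn: "c = n"
      have "extend_auto n f (chord n 0 c) = chord n 0 1"
        using extend_auto_C2[OF f c i(2) val] gen_arc_closed[of 0 1 n] cn i by (simp add: chord_linear)
      also have "\<dots> = chord n (Suc n) (Suc (Suc n))"
        using m by (intro aw_chords.E_cong) simp_all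
      also have "\<dots> = aw_chords.skein_chord n n (Suc n) (Suc (Suc n)) n"
        using i by (intro aw_chords.skein_chord_degenerate(1)[symmetric]) simp_all
      also have "\<dots> = aw_chords.skein_chord n n 0 1 n"
        using m by (intro aw_chords.skein_chord_cong) simp_all
      finally show ?thesis using cn 1 shift by simp
    next
      assume c1: "c = 1" "c < n"
      then have gen2: "gen2 (arc c n) (arc 0 1) = gen (arc 0 n)"
        using gen2_adjacent(2)[of 0 1 n] by simp
      have "extend_auto n f (chord n 0 c) = at_index n (gen2 (arc c n) (arc 0 1))"
        unfolding gen2 by (intro extend_auto_C2[OF f c i(2) val, unfolded gen2] gen_arc_closed) simp_all
      also have "\<dots> = chord n 0 n"
        unfolding gen2 by (simp add: chord_linear)
      also have "\<dots> = chord n n (Suc n)"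
        using aw_chords.E_shift(2)[of n n 0] sym[of 0 n] by simp
      also have "\<dots> = aw_chords.skein_chord n n (Suc n) (Suc (Suc n)) (Suc (Suc n))"
        using c1 by (intro aw_chords.skein_chord_degenerate(2)[symmetric]) simp_all
      also have "\<dots> = aw_chords.skein_chord n n 0 1 1"
        using m by (intro aw_chords.skein_chord_cong) simp_all
      finally show ?thesis using c1 1 shift by simp
    next
      assume c2: "1 < c" "c < n"
      have "extend_auto n f (chord n 0 c) = at_index n (gen2 (arc c n) (arc 0 1))"
        using c2 by (intro extend_auto_C2[OF f c i(2) val] gen2_closed) auto
      also have "\<dots> = aw_bracket.skein n (chord n 1 n) (chord n 0 c) (chord n c n) (chord n 0 1) (chord n 1 c) (chord n 0 n)"
        using c2 by (intro at_index_gen2) auto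
      also have "\<dots> = aw_chords.skein_chord n n 0 1 c"
      proof -
        have "chord n 1 c * chord n 0 n = chord n 0 n * chord n 1 c" "chord n c n * chord n 0 1 = chord n 0 1 * chord n c n"
          using aw_chords.E_commute[of 0 1 c n n] c2 by auto
        then show ?thesis
          by (subst swap) (simp add: aw_chords.skein_chord_def aw_bracket.skein_def sym[of n])
      qed
      finally show ?thesis using 1 shift by simp
    qed
  next
    case 2
    have shift: "aw_chords.skein_chord n (i + n) i (i + 1) c = aw_chords.skein_chord n (i - 1) i (i + 1) c"
    proof -
      have "i + n = i - 1 + Suc n" using 2 by simp
      then have "(i + n) mod Suc n = (i - 1) mod Suc n" by (simp only: mod_add_self2)
      then show ?thesis by (intro aw_chords.skein_chord_cong) auto
    qed
    have ii: "{i} = arc (i - 1) i" using 2 by auto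
    have val: "f (C n (arc i c)) = C2 n (arc (i - 1) i) (arc (i + 1) c)"
      using r 2 i unfolding is_r_def ii[symmetric] by auto
    show ?thesis
    proof (cases "c = i + 1")
      case True
      have "extend_auto n f (chord n i c) = chord n (i - 1) i"
        using extend_auto_C2[OF f 2(2) i(2) val] gen_arc_closed[of "i - 1" i n] True i 2
        by (simp add: chord_linear)
      also have "\<dots> = aw_chords.skein_chord n (i - 1) i (i + 1) c"
        using aw_chords.skein_chord_degenerate(2)[of "i - 1" i "i + 1" n] True 2 i by simp
      finally show ?thesis using shift by simp
    next
      case False
      then have c: "i + 1 < c" using 2 by simp
      have "extend_auto n f (chord n i c) = at_index n (gen2 (arc (i - 1) i) (arc (i + 1) c))"
        using c 2 i by (intro extend_auto_C2[OF f 2(2) i(2) val] gen2_closed) auto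
      also have "\<dots> = aw_chords.skein_chord n (i - 1) i (i + 1) c"
        using c 2 i unfolding aw_chords.skein_chord_def by (intro at_index_gen2) auto
      finally show ?thesis using shift by simp
    qed
  next
    case 3
    have shift: "aw_chords.skein_chord n (i + n) i (i + 1) c = aw_chords.skein_chord n (i - 1) i (i + 1) c"
    proof -
      have "i + n = i - 1 + Suc n" using 3 by simp
      then have "(i + n) mod Suc n = (i - 1) mod Suc n" by (simp only: mod_add_self2)
      then show ?thesis by (intro aw_chords.skein_chord_cong) auto
    qed
    have ii: "{i + 1} = arc i (i + 1)" using 3 by auto
    have val: "f (C n (arc c i)) = C2 n (arc i (i + 1)) (arc c (i - 1))"
      using r 3 i unfolding is_r_def ii[symmetric] by auto
    show ?thesis
    proof (cases "c = i - 1")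
      case True
      have "extend_auto n f (chord n c i) = chord n i (i + 1)"
        using extend_auto_C2[OF f 3(2) _ val] gen_arc_closed[of i "i + 1" n] True i 3
        by (simp add: chord_linear)
      also have "\<dots> = aw_chords.skein_chord n (i - 1) i (i + 1) c"
        using aw_chords.skein_chord_degenerate(1)[of "i - 1" i "i + 1" n] True 3 i by simp
      finally show ?thesis using shift sym[of i c] by simp
    next
      case False
      then have c: "c < i - 1" using 3 by simp
      have "extend_auto n f (chord n c i) = at_index n (gen2 (arc i (i + 1)) (arc c (i - 1)))"
        using c 3 i by (intro extend_auto_C2[OF f 3(2) _ val] gen2_closed) auto
      also have "\<dots> = aw_bracket.skein n (chord n (i - 1) (i + 1)) (chord n c i)
          (chord n i (i + 1)) (chord n c (i - 1)) (chord n (i - 1) i) (chord n c (i + 1))"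
        using c 3 i by (intro at_index_gen2) auto
      also have "\<dots> = aw_chords.skein_chord n (i - 1) i (i + 1) c"
        by (subst swap) (simp add: aw_chords.skein_chord_def sym[of c])
      finally show ?thesis using shift sym[of i c] by simp
    qed
  qed
qed

section \<open>The relations satisfied by the twists\<close>

locale aw_twists =
  fixes n :: nat and r :: "nat \<Rightarrow> nat set free set \<Rightarrow> nat set free set"
  assumes n_pos: "n > 0" and is_r: "i < n \<Longrightarrow> is_r n i (r i)"
begin

text \<open>The identity is the default beyond the range because \<open>twists\<close> asks every
  \<open>R i\<close> to be a homomorphism.\<close>

definition twist :: "nat \<Rightarrow> aw_product \<Rightarrow> aw_product" where
  "twist i = extend_auto n (if i < n then r i else \<one>\<^bsub>AlgAut (aw n)\<^esub>)"

lemma twist_eq: "i < n \<Longrightarrow> twist i = extend_auto n (r i)"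
  by (simp add: twist_def)

lemma r_auto: "i < n \<Longrightarrow> r i \<in> alg_auto (aw n)"
  using is_r by (simp add: is_r_def)

lemma twist_auto: "(if i < n then r i else \<one>\<^bsub>AlgAut (aw n)\<^esub>) \<in> alg_auto (aw n)"
  using r_auto monoid.one_closed[OF group.is_monoid[OF group_AlgAut]] by simp

lemma chord_mod: "chord n (a mod Suc n) (b mod Suc n) = chord n a b"
  by (simp add: chord_def)

lemma twist_fix:
  assumes "i < n" "a mod Suc n \<noteq> i" "b mod Suc n \<noteq> i"
  shows "twist i (chord n a b) = chord n a b"
proof -
  have *: "twist i (chord n a b) = chord n a b" if "a < b" "b \<le> n" "a \<noteq> i" "b \<noteq> i" for a b
    using is_r_fix_linear[OF is_r[OF assms(1)] that] assms(1) by (simp add: twist_def)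
  have le: "a mod Suc n \<le> n" "b mod Suc n \<le> n" by (simp_all flip: less_Suc_eq_le)
  have "twist i (chord n (a mod Suc n) (b mod Suc n)) = chord n (a mod Suc n) (b mod Suc n)"
  proof (cases "a mod Suc n" "b mod Suc n" rule: linorder_cases)
    case less
    then show ?thesis using * le assms by blast
  next
    case equal
    then show ?thesis
      using extend_auto_hom(3)[OF alg_autoD(1)[OF twist_auto]] by (simp add: twist_def aw_chords.E_refl)
  next
    case greater
    then show ?thesis using *[of "b mod Suc n" "a mod Suc n"] le assms aw_chords.E_sym[of n] by metis
  qed
  then show ?thesis by (simp only: chord_mod)
qed

lemma twist_move:
  assumes "i < n" "c mod Suc n \<noteq> i"
  shows "twist i (chord n i c) = aw_chords.skein_chord n (i + n) i (i + 1) c"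
proof -
  have "c mod Suc n \<le> n" by (simp flip: less_Suc_eq_le)
  then have "twist i (chord n i (c mod Suc n)) = aw_chords.skein_chord n (i + n) i (i + 1) (c mod Suc n)"
    using is_r_move_linear[OF is_r[OF assms(1)] assms(1)] assms by (simp add: twist_def)
  moreover have "chord n i (c mod Suc n) = chord n i c"
    by (intro aw_chords.E_cong) simp_all
  moreover have "aw_chords.skein_chord n (i + n) i (i + 1) (c mod Suc n) = aw_chords.skein_chord n (i + n) i (i + 1) c"
    by (intro aw_chords.skein_chord_cong) simp_all
  ultimately show ?thesis by simp
qed

sublocale tw: twists "scalar n" "Suc n" "chord n" 0 twist
proof unfold_locales
  note hom = alg_autoD(1)[OF twist_auto]
  show "twist i (x + y) = twist i x + twist i y" "twist i (x * y) = twist i x * twist i y" "twist i 1 = 1"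
      "twist i (scalar n) = scalar n" for i x y
    unfolding twist_def using extend_auto_hom[OF hom] extend_auto_scalar[OF twist_auto] by blast+
  show "twist i (chord n a b) = chord n a b"
    if "i < Suc n - 1" "a mod Suc n \<noteq> (0 + i) mod Suc n" "b mod Suc n \<noteq> (0 + i) mod Suc n" for i a b
    using that by (intro twist_fix) simp_all
  show "twist i (chord n (0 + i) c) = aw_chords.skein_chord n (0 + i + Suc n - 1) (0 + i) (0 + i + 1) c"
    if "i < Suc n - 1" "c mod Suc n \<noteq> (0 + i) mod Suc n" for i c
    using that twist_move[of i c] by simp
qed

text \<open>
  The reflected polygon satisfies the same relations, and the product \<open>r\<^sub>0 \<cdots> r\<^sub>n\<^sub>-\<^sub>1\<close> sweeps over it in the
  same way as \<open>r\<^sub>n\<^sub>-\<^sub>1 \<cdots> r\<^sub>0\<close> sweeps over the original one.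
\<close>

abbreviation refl_chord :: "nat \<Rightarrow> nat \<Rightarrow> aw_product" where
  "refl_chord i j \<equiv> chord n (n - i mod Suc n) (n - j mod Suc n)"

sublocale rtw: twists "scalar n" "Suc n" refl_chord 1 "\<lambda>i. twist (n - Suc i)"
  using tw.twists_reflect n_pos by simp

sublocale G: group "AlgAut (aw n)"
  by (rule group_AlgAut)

sublocale G: generated_family "AlgAut (aw n)" n r
  by unfold_locales (simp add: r_auto)

lemma extend_auto_desc: "m \<le> n \<Longrightarrow> extend_auto n (G.desc 0 m) x = tw.sweep m x"
proof (induction m)
  case 0
  then show ?case by (simp add: extend_auto_one tw.sweep.simps)
next
  case (Suc m)
  have "G.desc 0 m \<in> alg_auto (aw n)" using G.desc_closed[of m 0] Suc.prems by simp
  then show ?case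
    using Suc by (simp add: G.desc_Suc extend_auto_mult r_auto tw.sweep.simps twist_eq)
qed

text \<open>The rightmost factor acts first, so r (n - 1), r (n - 2), ... are applied in the order
  of the mirrored vertices 1, 2, ...\<close>

lemma extend_auto_asc: "m \<le> n \<Longrightarrow> extend_auto n (G.asc (n - m) n) x = rtw.sweep m x"
proof (induction m)
  case 0
  then show ?case by (simp add: extend_auto_one rtw.sweep.simps)
next
  case (Suc m)
  let ?i = "n - Suc m"
  have i: "?i < n" "Suc ?i = n - m" using Suc.prems by auto
  have "G.asc (n - m) n \<in> alg_auto (aw n)" using G.asc_closed[of n "n - m"] by simp
  moreover have "G.asc ?i n = r ?i \<otimes>\<^bsub>AlgAut (aw n)\<^esub> G.asc (n - m) n"
    using G.asc_Suc_left[of ?i n] i by simp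
  moreover have "rtw.sweep (Suc m) x = extend_auto n (r ?i) (rtw.sweep m x)"
    by (simp only: rtw.sweep.simps twist_eq[OF i(1)])
  ultimately show ?case
    using Suc.IH Suc.prems i by (simp only: extend_auto_mult r_auto Suc_leD)
qed

lemma extend_auto_desc_chord: "extend_auto n (G.desc 0 n) (chord n a b) = chord n (a + n) (b + n)"
  using tw.sweep_chord[of a b] by (simp add: extend_auto_desc)

lemma extend_auto_asc_chord: "extend_auto n (G.asc 0 n) (chord n a b) = chord n (a + 1) (b + 1)"
proof -
  \<comment> \<open>Reflecting, going back one step and reflecting again is one step
    forward.\<close>
  have res: "(n - (n - u mod Suc n + n) mod Suc n) mod Suc n = (u + 1) mod Suc n" for u
  proof (cases "u mod Suc n = n")
    case True
    then have "Suc u mod Suc n = 0" by (simp add: mod_Suc)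
    then show ?thesis using True by simp
  next
    case False
    moreover have "u mod Suc n \<le> n" by (simp flip: less_Suc_eq_le)
    ultimately have lt: "u mod Suc n < n" by linarith
    then have "n - u mod Suc n + n = n - u mod Suc n - 1 + Suc n" by simp
    then have "(n - u mod Suc n + n) mod Suc n = n - u mod Suc n - 1"
      by (simp only: mod_add_self2) simp
    moreover have "n - (n - u mod Suc n - 1) = Suc (u mod Suc n)" using lt by simp
    moreover have "(u + 1) mod Suc n = Suc (u mod Suc n)"
      using False by (simp add: mod_Suc)
    ultimately show ?thesis using lt by simp
  qed
  have le: "u mod Suc n \<le> n" for u by (simp flip: less_Suc_eq_le)
  have "refl_chord (n - a mod Suc n) (n - b mod Suc n) = chord n a b"
    using le by (simp add: chord_mod)
  moreover have "rtw.sweep n (refl_chord (n - a mod Suc n) (n - b mod Suc n)) =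
      refl_chord (n - a mod Suc n + n) (n - b mod Suc n + n)"
    using rtw.sweep_chord[of "n - a mod Suc n" "n - b mod Suc n"] by simp
  moreover have "refl_chord (n - a mod Suc n + n) (n - b mod Suc n + n) = chord n (a + 1) (b + 1)"
    using res by (intro aw_chords.E_cong) simp_all
  ultimately show ?thesis using extend_auto_asc[of n] by simp
qed

lemma desc_asc: "G.desc 0 n \<otimes>\<^bsub>AlgAut (aw n)\<^esub> G.asc 0 n = \<one>\<^bsub>AlgAut (aw n)\<^esub>"
proof (rule alg_auto_eqI)
  have c: "G.desc 0 n \<in> alg_auto (aw n)" "G.asc 0 n \<in> alg_auto (aw n)"
    using G.desc_closed[of n 0] G.asc_closed[of n 0] by simp_all
  show "G.desc 0 n \<otimes>\<^bsub>AlgAut (aw n)\<^esub> G.asc 0 n \<in> alg_auto (aw n)" "\<one>\<^bsub>AlgAut (aw n)\<^esub> \<in> alg_auto (aw n)"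
    using G.m_closed[of "G.desc 0 n" "G.asc 0 n"] c G.one_closed by simp_all
  fix a b
  have "extend_auto n (G.desc 0 n \<otimes>\<^bsub>AlgAut (aw n)\<^esub> G.asc 0 n) (chord n a b) = chord n (a + 1 + n) (b + 1 + n)"
    using c by (simp add: extend_auto_mult extend_auto_asc_chord extend_auto_desc_chord)
  also have "\<dots> = chord n a b"
    using aw_chords.E_shift(1)[of n a "b + Suc n"] aw_chords.E_shift(2)[of n a b] by simp
  finally show "extend_auto n (G.desc 0 n \<otimes>\<^bsub>AlgAut (aw n)\<^esub> G.asc 0 n) (chord n a b) =
      extend_auto n \<one>\<^bsub>AlgAut (aw n)\<^esub> (chord n a b)"
    by (simp add: extend_auto_one)
qed

lemma desc_pow: "G.desc 0 n [^]\<^bsub>AlgAut (aw n)\<^esub> Suc n = \<one>\<^bsub>AlgAut (aw n)\<^esub>"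
proof (rule alg_auto_eqI)
  have c: "G.desc 0 n \<in> alg_auto (aw n)"
    using G.desc_closed[of n 0] by simp
  have pow: "G.desc 0 n [^]\<^bsub>AlgAut (aw n)\<^esub> (m :: nat) \<in> alg_auto (aw n)" for m
    using G.nat_pow_closed[of "G.desc 0 n" m] c by simp
  show "G.desc 0 n [^]\<^bsub>AlgAut (aw n)\<^esub> Suc n \<in> alg_auto (aw n)"
    by (rule pow)
  show "\<one>\<^bsub>AlgAut (aw n)\<^esub> \<in> alg_auto (aw n)"
    using G.one_closed by simp
  fix a b
  have "extend_auto n (G.desc 0 n [^]\<^bsub>AlgAut (aw n)\<^esub> m) (chord n a b) = chord n (a + m * n) (b + m * n)" for m :: nat
  proof (induction m arbitrary: a b)
    case 0
    then show ?case by (simp add: extend_auto_one)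
  next
    case (Suc m)
    then show ?case using c pow by (simp add: extend_auto_mult extend_auto_desc_chord add.assoc)
  qed
  then have "extend_auto n (G.desc 0 n [^]\<^bsub>AlgAut (aw n)\<^esub> Suc n) (chord n a b) =
      chord n (a + Suc n * n) (b + Suc n * n)" .
  also have "\<dots> = chord n a b"
    by (intro aw_chords.E_cong) (simp_all only: mod_mult_self2)
  finally show "extend_auto n (G.desc 0 n [^]\<^bsub>AlgAut (aw n)\<^esub> Suc n) (chord n a b) =
      extend_auto n \<one>\<^bsub>AlgAut (aw n)\<^esub> (chord n a b)"
    by (simp add: extend_auto_one)
qed

sublocale G: commuting_family "AlgAut (aw n)" n r
proof unfold_locales
  fix i j assume ij: "Suc i < j" "j < n"
  then have c: "r i \<in> alg_auto (aw n)" "r j \<in> alg_auto (aw n)" using r_auto by simp_all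
  show "r i \<otimes>\<^bsub>AlgAut (aw n)\<^esub> r j = r j \<otimes>\<^bsub>AlgAut (aw n)\<^esub> r i"
  proof (rule alg_auto_eqI)
    show "r i \<otimes>\<^bsub>AlgAut (aw n)\<^esub> r j \<in> alg_auto (aw n)" "r j \<otimes>\<^bsub>AlgAut (aw n)\<^esub> r i \<in> alg_auto (aw n)"
      using G.m_closed[of "r i" "r j"] G.m_closed[of "r j" "r i"] c by simp_all
    show "extend_auto n (r i \<otimes>\<^bsub>AlgAut (aw n)\<^esub> r j) (chord n a b) = extend_auto n (r j \<otimes>\<^bsub>AlgAut (aw n)\<^esub> r i) (chord n a b)" for a b
      using tw.R_commute[of i j a b] ij c by (simp add: extend_auto_mult twist_def)
  qed
qed

lemma desc_shift:
  assumes i: "Suc i < n"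
  shows "G.desc 0 n \<otimes>\<^bsub>AlgAut (aw n)\<^esub> r (Suc i) = r i \<otimes>\<^bsub>AlgAut (aw n)\<^esub> G.desc 0 n"
proof (rule alg_auto_eqI)
  have c: "G.desc 0 n \<in> alg_auto (aw n)" "r i \<in> alg_auto (aw n)" "r (Suc i) \<in> alg_auto (aw n)"
    using G.desc_closed[of n 0] r_auto i by simp_all
  show "G.desc 0 n \<otimes>\<^bsub>AlgAut (aw n)\<^esub> r (Suc i) \<in> alg_auto (aw n)" "r i \<otimes>\<^bsub>AlgAut (aw n)\<^esub> G.desc 0 n \<in> alg_auto (aw n)"
    using G.m_closed[of "G.desc 0 n" "r (Suc i)"] G.m_closed[of "r i" "G.desc 0 n"] c by simp_all
  show "extend_auto n (G.desc 0 n \<otimes>\<^bsub>AlgAut (aw n)\<^esub> r (Suc i)) (chord n a b) =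
      extend_auto n (r i \<otimes>\<^bsub>AlgAut (aw n)\<^esub> G.desc 0 n) (chord n a b)" for a b
    using tw.sweep_R[of i a b] i c by (simp add: extend_auto_mult extend_auto_desc twist_def)
qed

sublocale G: braid_family "AlgAut (aw n)" n r
  by unfold_locales (rule G.braid_relations_if_shift[OF desc_shift])

end

theorem proposition3p9:
  fixes n :: nat and r :: "nat \<Rightarrow> nat set free set \<Rightarrow> nat set free set"
  assumes "n \<ge> 3"
    and "\<And>a. a < n \<Longrightarrow> is_r n a (r a)"
  shows "half_twist_relations (AlgAut (aw n)) r n
    \<and> (\<forall>(G :: ('g, 'm) monoid_scheme) \<rho>.
         group G \<and> (\<forall>a<n. \<rho> a \<in> carrier G) \<and> braid_relations G \<rho> n \<longrightarrow>
         (half_twist_relations G \<rho> n \<longleftrightarrow> sphere_relations G \<rho> n))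
    \<and> sphere_relations (AlgAut (aw n)) r n
    \<and> r 0 [^]\<^bsub>AlgAut (aw n)\<^esub> (2::nat) =
        mprod (AlgAut (aw n)) (map (\<lambda>i. inv\<^bsub>AlgAut (aw n)\<^esub> (r i)) [1..<n-1])
        \<otimes>\<^bsub>AlgAut (aw n)\<^esub> (inv\<^bsub>AlgAut (aw n)\<^esub> (r (n-1))) [^]\<^bsub>AlgAut (aw n)\<^esub> (2::nat)
        \<otimes>\<^bsub>AlgAut (aw n)\<^esub>
        mprod (AlgAut (aw n)) (map (\<lambda>i. inv\<^bsub>AlgAut (aw n)\<^esub> (r i)) (rev [1..<n-1]))
    \<and> r 0 [^]\<^bsub>AlgAut (aw n)\<^esub> (2::nat) = \<Delta> (AlgAut (aw n)) r 2 (n-1) [^]\<^bsub>AlgAut (aw n)\<^esub> (2::nat)"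
proof -
  interpret aw_twists n r
    using assms by unfold_locales simp_all
  have n: "n > 1" using assms by simp
  have equiv: "half_twist_relations G \<rho> n \<longleftrightarrow> sphere_relations G \<rho> n"
    if "group G" "\<forall>a<n. \<rho> a \<in> carrier G" "braid_relations G \<rho> n" for G :: "('g, 'm) monoid_scheme" and \<rho>
  proof -
    interpret B: braid_family G n \<rho>
      using that by (simp add: braid_family_def braid_family_axioms_def generated_family_def generated_family_axioms_def)
    show ?thesis using n by (rule B.half_twist_iff_sphere)
  qed
  \<comment> \<open>The properties of the rotation give the sphere relations first; the half twist
    relations then come from the equivalence, valid here as the braid relations are
    established.\<close>
  have sphere: "sphere_relations (AlgAut (aw n)) r n"
    using n desc_pow desc_asc by (rule G.sphere_relations_if_pow)
  then have "half_twist_relations (AlgAut (aw n)) r n"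
    using G.half_twist_iff_sphere[OF n] by simp
  then show ?thesis
    using equiv sphere G.sphere_relations_square[OF n sphere] by blast
qed

end
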